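(* Let $L$ be a square integrable martingale and assume that $\sqrt{|\Theta(1)|}$ is integrable (or, equivalently, $\int_{\{|\theta|>1\}}\sqrt{|\theta|}\,F(d\theta)<\infty$). Then the subordinated process $X(t)=L(\Theta(t))$ is integrable and mean zero.
   Context: Setting. $d\in\mathbb N$; for $j=1,\dots,d$, $H_j$ is a separable real Hilbert space and $L_j$ is an $H_j$-valued càdlàg Lévy process; $L_1,\dots,L_d$ are independent. $H:=H_1\times\dots\times H_d$ with $\langle u|v\rangle=\sum_j\langle u_j|v_j\rangle_j$; $L=(L_1,\dots,L_d)$; $L(\theta):=(L_1(\theta_1),\dots,L_d(\theta_d))$ for $\theta\in\mathbb R_+^d$. $\Theta=(\Theta_1,\dots,\Theta_d)$ is an $\mathbb R^d$-valued càdlàg Lévy process, independent of $L$, such that each $\Theta_j$ is a subordinator; $F$ is the Lévy measure of $\Theta$ (concentrated on $\mathbb R_+^d$). A process $Y$ is integrable (square integrable) if $\mathrm{E}|Y(t)|<\infty$ (resp. $\mathrm{E}|Y(t)|^2<\infty$) for all $t\ge0$; it is mean zero if it is integrable and $\mathrm{E}Y(t)=0$ for all $t\ge0$. For the Lévy process $L$, being a martingale (w.r.t. its own filtration) is the same as being mean zero. *)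

theory Defs
  imports "HOL-Probability.Probability"
begin

text \<open>Needed for Bochner integration of functions with values in
  \<open>'h ^ 'd\<close> when \<open>'h\<close> is not finite-dimensional.\<close>

instance vec :: ("{metric_space, second_countable_topology}", finite) second_countable_topology
proof
  obtain B :: "'a set set" where B: "countable B" "topological_basis B"
    using ex_countable_basis by blast
  define C :: "('a ^ 'b) set set" where
    "C = (\<lambda>f. {x. \<forall>i. x $ i \<in> f i}) ` (PiE UNIV (\<lambda>_. B))"
  have "countable C"
    unfolding C_def by (intro countable_image countable_PiE) (auto simp: B)
  moreover have "topological_basis C"
  proof (rule topological_basisI)
    fix S assume "S \<in> C"
    then obtain f where "f \<in> PiE UNIV (\<lambda>_. B)" and S: "S = {x. \<forall>i. x $ i \<in> f i}"
      unfolding C_def by (rule imageE) simp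
    then have f: "\<forall>i. f i \<in> B"
      by (simp add: PiE_def Pi_def)
    have "\<forall>i. open (f i)"
      using f topological_basis_open[OF B(2)] by blast
    then show "open S"
      unfolding S open_vec_def by (intro ballI) (rule exI[of _ f], auto)
  next
    fix O' :: "('a ^ 'b) set" and x assume "open O'" "x \<in> O'"
    then obtain A where A: "\<forall>i. open (A i) \<and> x $ i \<in> A i"
      and sub: "\<forall>y. (\<forall>i. y $ i \<in> A i) \<longrightarrow> y \<in> O'"
      unfolding open_vec_def by blast
    have "\<forall>i. \<exists>U\<in>B. x $ i \<in> U \<and> U \<subseteq> A i"
      using A topological_basisE[OF B(2)] by metis
    then obtain f where f: "f i \<in> B" "x $ i \<in> f i" "f i \<subseteq> A i" for i
      by metis
    let ?V = "{x. \<forall>i. x $ i \<in> f i}"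
    have "?V \<in> C"
      unfolding C_def using f(1) by (intro imageI) (simp add: PiE_def Pi_def)
    moreover have "?V \<subseteq> O'"
      using f(3) sub by blast
    ultimately show "\<exists>B'\<in>C. x \<in> B' \<and> B' \<subseteq> O'"
      using f(2) by (intro bexI[of _ ?V]) simp
  qed
  ultimately show "\<exists>B::('a ^ 'b) set set. countable B \<and> open = generate_topology B"
    using topological_basis_imp_subbasis by blast
qed

text \<open>A process is a function \<open>X :: real \<Rightarrow> 'a \<Rightarrow> 'b\<close>; only the values \<open>X t\<close> with \<open>t \<ge> 0\<close>
  are meaningful.\<close>

definition cadlag :: "(real \<Rightarrow> 'b::topological_space) \<Rightarrow> bool" where
  "cadlag f \<longleftrightarrow> (\<forall>t\<ge>0. (f \<longlongrightarrow> f t) (at_right t)) \<and> (\<forall>t>0. \<exists>l. (f \<longlongrightarrow> l) (at_left t))"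

definition cadlag_levy_process ::
    "'a measure \<Rightarrow> (real \<Rightarrow> 'a \<Rightarrow> 'b::{real_normed_vector, second_countable_topology}) \<Rightarrow> bool" where
  "cadlag_levy_process M X \<longleftrightarrow>
     (\<forall>t\<ge>0. X t \<in> borel_measurable M) \<and>
     (AE \<omega> in M. X 0 \<omega> = 0) \<and>
     (\<forall>(n::nat) \<tau>. 0 \<le> \<tau> 0 \<longrightarrow> (\<forall>i<n. \<tau> i < \<tau> (Suc i)) \<longrightarrow>
        prob_space.indep_vars M (\<lambda>_. borel) (\<lambda>i \<omega>. X (\<tau> (Suc i)) \<omega> - X (\<tau> i) \<omega>) {..<n}) \<and>
     (\<forall>s\<ge>0. \<forall>t\<ge>0. distr M borel (\<lambda>\<omega>. X (s + t) \<omega> - X s \<omega>) = distr M borel (X t)) \<and>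
     (\<forall>t\<ge>0. \<forall>\<epsilon>>0. ((\<lambda>s. measure M {\<omega> \<in> space M. \<epsilon> < norm (X s \<omega> - X t \<omega>)}) \<longlongrightarrow> 0)
        (at t within {0..})) \<and>
     (AE \<omega> in M. cadlag (\<lambda>t. X t \<omega>))"

definition subordinator :: "'a measure \<Rightarrow> (real \<Rightarrow> 'a \<Rightarrow> real) \<Rightarrow> bool" where
  "subordinator M X \<longleftrightarrow>
     cadlag_levy_process M X \<and> (AE \<omega> in M. mono_on {0..} (\<lambda>t. X t \<omega>))"

text \<open>The Levy measure, as the measure in the Levy--Khintchine representation of the law of
  \<open>X 1\<close> with truncation function \<open>indicator (cball 0 1)\<close>: \<open>\<gamma>\<close> is the drift and \<open>A\<close> the
  Gaussian covariance matrix.\<close>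

definition levy_measure_of ::
    "'a measure \<Rightarrow> (real \<Rightarrow> 'a \<Rightarrow> real ^ 'd::finite) \<Rightarrow> (real ^ 'd) measure \<Rightarrow> bool" where
  "levy_measure_of M X F \<longleftrightarrow>
     sets F = sets borel \<and>
     emeasure F {0} = 0 \<and>
     (\<integral>\<^sup>+ x. ennreal (min 1 ((norm x)\<^sup>2)) \<partial>F) < \<infinity> \<and>
     (\<exists>(\<gamma> :: real ^ 'd) (A :: real ^ 'd ^ 'd).
        transpose A = A \<and> (\<forall>u. 0 \<le> u \<bullet> (A *v u)) \<and>
        (\<forall>u. (CLINT \<omega>|M. iexp (u \<bullet> X 1 \<omega>)) =
           exp (\<i> * complex_of_real (u \<bullet> \<gamma>) - complex_of_real (u \<bullet> (A *v u)) / 2 +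
             (CLINT x|F. (iexp (u \<bullet> x) - 1
                - \<i> * complex_of_real ((u \<bullet> x) * indicator (cball 0 1) x))))))"

definition integrable_process ::
    "'a measure \<Rightarrow> (real \<Rightarrow> 'a \<Rightarrow> 'b::{banach, second_countable_topology}) \<Rightarrow> bool" where
  "integrable_process M Y \<longleftrightarrow> (\<forall>t\<ge>0. integrable M (Y t))"

definition square_integrable_process ::
    "'a measure \<Rightarrow> (real \<Rightarrow> 'a \<Rightarrow> 'b::{banach, second_countable_topology}) \<Rightarrow> bool" where
  "square_integrable_process M Y \<longleftrightarrow>
     (\<forall>t\<ge>0. Y t \<in> borel_measurable M \<and> integrable M (\<lambda>\<omega>. (norm (Y t \<omega>))\<^sup>2))"

definition mean_zero ::
    "'a measure \<Rightarrow> (real \<Rightarrow> 'a \<Rightarrow> 'b::{banach, second_countable_topology}) \<Rightarrow> bool" where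
  "mean_zero M Y \<longleftrightarrow>
     integrable_process M Y \<and> (\<forall>t\<ge>0. integral\<^sup>L M (Y t) = 0)"

text \<open>\<open>natural_filtration M Y t\<close> is \<open>\<sigma>(Y s : s \<le> t)\<close> and \<open>generated_sigma_algebra M Y\<close> is
  \<open>\<sigma>(Y s : s \<ge> 0)\<close>; independence of processes is independence of the latter.\<close>

definition natural_filtration ::
    "'a measure \<Rightarrow> (real \<Rightarrow> 'a \<Rightarrow> 'b::topological_space) \<Rightarrow> real \<Rightarrow> 'a set set" where
  "natural_filtration M Y t =
     sigma_sets (space M) {Y s -` B \<inter> space M | s B. 0 \<le> s \<and> s \<le> t \<and> B \<in> sets borel}"

definition generated_sigma_algebra ::
    "'a measure \<Rightarrow> (real \<Rightarrow> 'a \<Rightarrow> 'b::topological_space) \<Rightarrow> 'a set set" where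
  "generated_sigma_algebra M Y =
     sigma_sets (space M) {Y s -` B \<inter> space M | s B. 0 \<le> s \<and> B \<in> sets borel}"

text \<open>The library's conditional expectation is real-valued only, so
  \<open>E (Y t | natural_filtration M Y s) = Y s\<close> is written out as the defining equation of the
  conditional expectation; adaptedness is automatic.\<close>

definition martingale_own_filtration ::
    "'a measure \<Rightarrow> (real \<Rightarrow> 'a \<Rightarrow> 'b::{banach, second_countable_topology}) \<Rightarrow> bool" where
  "martingale_own_filtration M Y \<longleftrightarrow>
     integrable_process M Y \<and>
     (\<forall>s t. 0 \<le> s \<longrightarrow> s \<le> t \<longrightarrow> (\<forall>A \<in> natural_filtration M Y s.
        set_lebesgue_integral M A (Y t) = set_lebesgue_integral M A (Y s)))"

text \<open>The norm of \<open>'h ^ 'd\<close> is the Hilbert norm of the product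
  \<open>H\<^sub>1 \<times> \<dots> \<times> H\<^sub>d\<close>.\<close>

definition joint_process :: "('d \<Rightarrow> real \<Rightarrow> 'a \<Rightarrow> 'h) \<Rightarrow> real \<Rightarrow> 'a \<Rightarrow> 'h ^ 'd::finite" where
  "joint_process L t \<omega> = (\<chi> j. L j t \<omega>)"

definition subordinated_process ::
    "('d \<Rightarrow> real \<Rightarrow> 'a \<Rightarrow> 'h) \<Rightarrow> (real \<Rightarrow> 'a \<Rightarrow> real ^ 'd) \<Rightarrow> real \<Rightarrow> 'a \<Rightarrow> 'h ^ 'd::finite" where
  "subordinated_process L \<Theta> t \<omega> = (\<chi> j. L j (\<Theta> t \<omega> $ j) \<omega>)"

text \<open>The Hilbert spaces \<open>H j\<close> are realised as closed subspaces of one separable Hilbert space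
  \<open>'h\<close>; any finite family of separable Hilbert spaces arises this way (inside its direct sum).

  Path properties are only required almost surely, so \<open>X t\<close> is a random variable up to
  null sets, i.e. with respect to \<open>completion M\<close>; this is where its integrals are taken.\<close>

locale subordination_setting =
  fixes M :: "'a measure"
    and H :: "'d::finite \<Rightarrow> 'h::{real_inner, banach, second_countable_topology} set"
    and L :: "'d \<Rightarrow> real \<Rightarrow> 'a \<Rightarrow> 'h"
    and \<Theta> :: "real \<Rightarrow> 'a \<Rightarrow> real ^ 'd"
    and F :: "(real ^ 'd) measure"
  assumes prob: "prob_space M"
    and H_subspace: "\<And>j. subspace (H j)"
    and H_closed: "\<And>j. closed (H j)"
    and L_in_H: "\<And>j t \<omega>. 0 \<le> t \<Longrightarrow> \<omega> \<in> space M \<Longrightarrow> L j t \<omega> \<in> H j"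
    and L_levy: "\<And>j. cadlag_levy_process M (L j)"
    and L_indep: "prob_space.indep_sets M (\<lambda>j. generated_sigma_algebra M (L j)) UNIV"
    and Theta_levy: "cadlag_levy_process M \<Theta>"
    and Theta_subordinator: "\<And>j. subordinator M (\<lambda>t \<omega>. \<Theta> t \<omega> $ j)"
    and Theta_L_indep:
      "prob_space.indep_set M (generated_sigma_algebra M \<Theta>)
         (generated_sigma_algebra M (joint_process L))"
    and F_levy_measure: "levy_measure_of M \<Theta> F"

end

theory Submission
  imports Defs
begin

text \<open>Both parts of the theorem rest on how the function \<open>sqrt\<close> relates to the two kinds of data:
to characteristic functions in the equivalence, and to the growth of \<open>L\<close> in the statement on
the subordinated process.

For the equivalence, \<open>sqrt \<bar>y\<bar>\<close> is comparable, for \<open>\<bar>y\<bar> \<ge> 1\<close>, to the series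
\<open>\<Sum>n. 2 ^ n * (1 - cos (y / 4 ^ n))\<close>: the weights double whenever the argument shrinks by a factor
of four, which is the scaling of the square root. Integrating termwise, a square root moment
is finite if and only if the values of \<open>1 - Re \<phi>\<close> at \<open>1 / 4 ^ n\<close> are summable against \<open>2 ^ n\<close>
(\<open>sqrt_moment_finite_iff_cos_series\<close>). The Levy--Khintchine formula compares these values for the
law of \<open>\<Theta> 1\<close> and for the restriction of \<open>F\<close> to large jumps, up to a bounded factor and an error
that is linear in the argument and therefore summable
(\<open>levy_characteristic_function_bounds\<close>, \<open>levy_sqrt_moment_iff\<close>).

For the subordinated process, a mean-zero square integrable Levy process has orthogonal
increments, so its second moment grows linearly in time and \<open>E (norm (L j s))\<close> is at most a
constant times \<open>1 + sqrt s\<close> (\<open>levy_first_moment_le\<close>). As \<open>\<Theta>\<close> is independent of \<open>L\<close>, one may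
freeze the random time and apply Fubini's theorem: the mean of the norm of \<open>L j\<close> at time
\<open>\<Theta> t $ j\<close> is at most a constant times \<open>1 + E (sqrt (\<Theta> t $ j))\<close>, and its mean is an average of zeros
(\<open>integrable_independent_time_change\<close>). The hypothesis at time \<open>1\<close> gives finite square root
moments at all times because \<open>sqrt\<close> is subadditive (\<open>subordinator_sqrt_integrable\<close>). All paths
being regular only almost surely, the time-changed process is first replaced by a measurable
version and then identified with it in the completion of the measure.\<close>

section \<open>Square roots as cosine series\<close>

lemma borel_measurable_vec_nth [measurable (raw)]:
  fixes f :: "'a \<Rightarrow> 'b::topological_space ^ 'd::finite"
  assumes "f \<in> borel_measurable M"
  shows "(\<lambda>x. f x $ j) \<in> borel_measurable M"
  using assms by (rule borel_measurable_continuous_on[rotated]) (intro continuous_intros)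

lemma four_adic_scale:
  fixes y :: real
  assumes "1 \<le> y"
  obtains n :: nat where "4 ^ n \<le> y" "y < 4 ^ Suc n"
proof -
  define P where "P n \<longleftrightarrow> y < 4 ^ n" for n :: nat
  have "\<exists>n. P n" unfolding P_def by (rule real_arch_pow) simp
  then have P: "P (LEAST n. P n)" by (rule LeastI_ex)
  have "(LEAST n. P n) \<noteq> 0"
  proof
    assume "(LEAST n. P n) = 0"
    with P assms show False by (simp add: P_def)
  qed
  then obtain m where m: "(LEAST n. P n) = Suc m" by (cases "LEAST n. P n") auto
  have "\<not> P m" by (rule not_less_Least) (simp add: m)
  with P m show thesis by (intro that[of m]) (auto simp: P_def)
qed

text \<open>The interval \<open>[1, 4]\<close> lies between \<open>1\<close> and \<open>2 * pi - 1\<close>, so it keeps distance at least \<open>1\<close>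
from the zeros \<open>0\<close> and \<open>2 * pi\<close> of \<open>1 - cos\<close>. The base \<open>4\<close> of the scales below is chosen so
that one period of scales fits into this interval.\<close>

lemma cos_le_cos_one:
  fixes z :: real
  assumes "1 \<le> z" "z \<le> 4"
  shows "cos z \<le> cos 1"
proof (cases "z \<le> pi")
  case True
  with assms show ?thesis by (intro cos_monotone_0_pi_le) auto
next
  case False
  have "cos (2 * pi - z) \<le> cos 1"
    using assms False pi_gt3 by (intro cos_monotone_0_pi_le) auto
  then show ?thesis by (simp add: cos_diff)
qed

lemma cos_one_less_one: "cos (1::real) < 1"
  using cos_monotone_0_pi[of 0 1] pi_gt3 by simp

text \<open>A single term suffices: at the scale \<open>4 ^ n \<le> \<bar>y\<bar> < 4 ^ Suc n\<close> the weight \<open>2 ^ n\<close> is at least half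
of \<open>sqrt \<bar>y\<bar>\<close>, while \<open>\<bar>y\<bar> / 4 ^ n\<close> lies in \<open>[1, 4)\<close>, where \<open>1 - cos\<close> is bounded below.\<close>

lemma sqrt_le_cos_series:
  fixes y :: real
  assumes "1 \<le> \<bar>y\<bar>"
  shows "ennreal (sqrt \<bar>y\<bar>) \<le>
    ennreal (2 / (1 - cos 1)) * (\<Sum>n. ennreal (2 ^ n * (1 - cos (y / 4 ^ n))))"
proof -
  obtain n where n: "4 ^ n \<le> \<bar>y\<bar>" "\<bar>y\<bar> < 4 ^ Suc n"
    using four_adic_scale[OF assms] .
  have "sqrt \<bar>y\<bar> \<le> sqrt (4 ^ Suc n)"
    using n(2) by (intro real_sqrt_le_mono) simp
  also have "\<dots> = 2 * 2 ^ n" by (simp only: real_sqrt_mult real_sqrt_power real_sqrt_four power_Suc)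
  finally have 1: "sqrt \<bar>y\<bar> \<le> 2 * 2 ^ n" .
  have "cos (y / 4 ^ n) = cos (\<bar>y\<bar> / 4 ^ n)" by (cases "0 \<le> y") (simp_all only: abs_of_nonneg abs_of_neg not_le minus_divide_left[symmetric] cos_minus)
  also have "\<dots> \<le> cos 1" using n by (intro cos_le_cos_one) (auto simp: field_simps)
  finally have 2: "1 - cos 1 \<le> 1 - cos (y / 4 ^ n)" by simp
  have c: "0 < 1 - cos (1::real)" using cos_one_less_one by simp
  have "2 / (1 - cos 1) * (2 ^ n * (1 - cos 1)) = (2 :: real) * 2 ^ n"
    using c by (metis (no_types, opaque_lifting) less_irrefl mult.assoc mult.commute nonzero_eq_divide_eq)
  with 1 have "sqrt \<bar>y\<bar> \<le> 2 / (1 - cos 1) * (2 ^ n * (1 - cos 1))" by (simp only:)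
  also have "\<dots> \<le> 2 / (1 - cos 1) * (2 ^ n * (1 - cos (y / 4 ^ n)))"
    using 2 c by (intro mult_left_mono zero_le_power divide_nonneg_nonneg) linarith+
  finally have "ennreal (sqrt \<bar>y\<bar>) \<le> ennreal (2 / (1 - cos 1) * (2 ^ n * (1 - cos (y / 4 ^ n))))"
    by (rule ennreal_leI)
  also have "\<dots> = ennreal (2 / (1 - cos 1)) * ennreal (2 ^ n * (1 - cos (y / 4 ^ n)))"
    using c by (intro ennreal_mult mult_nonneg_nonneg divide_nonneg_nonneg) auto
  also have "\<dots> \<le> ennreal (2 / (1 - cos 1)) * (\<Sum>n. ennreal (2 ^ n * (1 - cos (y / 4 ^ n))))"
    using sum_le_suminf[of "\<lambda>n. ennreal (2 ^ n * (1 - cos (y / 4 ^ n)))" "{n}"]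
    by (intro mult_left_mono) (simp_all only: sum.insert sum.empty finite.emptyI empty_iff add_0_right
      summableI finite.intros zero_le not_False_eq_True simp_thms)
  finally show ?thesis .
qed

text \<open>The terms grow like \<open>2 ^ n\<close> up to the scale of \<open>y\<close> and decay like \<open>2 ^ - n\<close> beyond it, so both
parts of the series are geometric and dominated by the value \<open>sqrt y\<close> at the turning point.
The minimum is used in place of \<open>1 - cos\<close> because it also majorises the modulus of
\<open>iexp - 1\<close>, and hence controls the imaginary part of a characteristic exponent.\<close>

lemma min_series_le_sqrt:
  fixes y :: real
  assumes "0 \<le> y"
  shows "(\<Sum>n. ennreal (2 ^ n * min 2 (y / 4 ^ n))) \<le> ennreal (6 * (1 + sqrt y))"
proof -
  let ?y = "max 1 y"
  obtain N where N: "4 ^ N \<le> ?y" "?y < 4 ^ Suc N"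
    using four_adic_scale[of ?y] by auto
  have sq: "sqrt (4 ^ N) = 2 ^ N" for N :: nat
    by (simp add: real_sqrt_power)
  have 1: "2 ^ N \<le> sqrt ?y"
    using real_sqrt_le_mono[OF N(1)] by (simp only: sq)
  have 2: "sqrt ?y \<le> 2 * 2 ^ N"
    using real_sqrt_le_mono[of ?y "4 ^ Suc N"] N(2) by (simp only: sq) simp
  define a where "a n = 2 ^ n * min 2 (y / 4 ^ n)" for n :: nat
  have a0: "0 \<le> a n" for n using assms by (simp add: a_def)
  have tail: "a (n + N) \<le> ?y / 2 ^ N * (1 / 2) ^ n" for n
  proof -
    have "a (n + N) \<le> 2 ^ (n + N) * (?y / 4 ^ (n + N))"
      unfolding a_def
      by (intro mult_left_mono order_trans[OF min.cobounded2 divide_right_mono]) auto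
    also have "(2::real) ^ (n + N) * (?y / 4 ^ (n + N)) = ?y * (2 / 4) ^ (n + N)"
      by (simp only: power_divide) simp
    also have "\<dots> = ?y / 2 ^ N * (1 / 2) ^ n"
      by (simp add: power_add power_one_over field_simps)
    finally show ?thesis .
  qed
  have geo: "(\<lambda>n. ?y / 2 ^ N * (1 / 2) ^ n) sums (?y / 2 ^ N * 2)"
    using sums_mult[OF geometric_sums[of "1/2::real"], of "?y / 2 ^ N"] by simp
  have sum_tail: "summable (\<lambda>n. a (n + N))"
    using tail a0 by (intro summable_comparison_test[OF _ sums_summable[OF geo]] exI[of _ 0]) auto
  then have sa: "summable a" by (simp add: summable_iff_shift)
  have head: "(\<Sum>n<N. a n) \<le> 2 * 2 ^ N"
  proof -
    have "(\<Sum>n<N. a n) \<le> (\<Sum>n<N. 2 * 2 ^ n)"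
      unfolding a_def by (intro sum_mono) simp
    also have "\<dots> = 2 * (2 ^ N - 1)"
      by (simp add: sum_distrib_left[symmetric] mask_eq_sum_exp atLeast0LessThan geometric_sum)
    finally show ?thesis by simp
  qed
  have "suminf a = (\<Sum>n. a (n + N)) + (\<Sum>n<N. a n)"
    by (rule suminf_split_initial_segment[OF sa])
  also have "\<dots> \<le> ?y / 2 ^ N * 2 + 2 * 2 ^ N"
    using suminf_le[OF tail sum_tail sums_summable[OF geo]] sums_unique[OF geo] head by simp
  also have "?y / 2 ^ N \<le> 2 * sqrt ?y"
  proof -
    have "?y = sqrt ?y * sqrt ?y" by simp
    also have "\<dots> \<le> sqrt ?y * (2 * 2 ^ N)" using 2 by (intro mult_left_mono) auto
    finally show ?thesis by (simp add: field_simps)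
  qed
  finally have "suminf a \<le> 6 * sqrt ?y" using 1 by simp
  also have "\<dots> \<le> 6 * (1 + sqrt y)"
    using assms by (auto simp: max_def)
  finally have "ennreal (suminf a) \<le> ennreal (6 * (1 + sqrt y))" by (rule ennreal_leI)
  then show ?thesis
    unfolding suminf_ennreal2[OF a0 sa, symmetric] by (simp only: a_def)
qed

lemma one_minus_cos_le_min:
  fixes t :: real shows "1 - cos t \<le> min 2 \<bar>t\<bar>"
proof -
  have "1 - cos t = 2 * (sin (t/2))\<^sup>2" using cos_double_sin[of "t/2"] by simp
  also have "\<dots> \<le> 2 * \<bar>sin (t/2)\<bar>" 
    using mult_left_le[of "\<bar>sin (t/2)\<bar>" "\<bar>sin (t/2)\<bar>"] by (simp add: power2_eq_square flip: abs_mult)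
  also have "\<dots> \<le> \<bar>t\<bar>" using abs_sin_x_le_abs_x[of "t/2"] by simp
  finally show ?thesis using cos_ge_minus_one[of t] by simp
qed


lemma (in finite_measure) integrable_one_minus_cos:
  fixes Z :: "'a \<Rightarrow> real"
  assumes [measurable]: "Z \<in> borel_measurable M"
  shows "integrable M (\<lambda>x. 1 - cos (Z x))"
proof (rule integrable_const_bound[where B = 2])
  have "\<bar>1 - cos (Z x)\<bar> \<le> 2" for x
    using cos_ge_minus_one[of "Z x"] cos_le_one[of "Z x"] by linarith
  then show "AE x in M. norm (1 - cos (Z x)) \<le> 2" by simp
qed measurable

text \<open>The series dominates the square root only at arguments of modulus at least \<open>1\<close>. Elsewhere the
square root is at most \<open>1\<close>, which the total mass pays for.\<close>

lemma (in finite_measure) sqrt_moment_le_cos_series: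
  fixes Z :: "'a \<Rightarrow> real"
  assumes [measurable]: "Z \<in> borel_measurable M"
  shows "(\<integral>\<^sup>+ x. ennreal (sqrt \<bar>Z x\<bar>) \<partial>M) \<le> emeasure M (space M) +
    ennreal (2 / (1 - cos 1)) * (\<Sum>n. ennreal (2 ^ n * (\<integral>x. 1 - cos (Z x / 4 ^ n) \<partial>M)))"
proof -
  have pointwise: "ennreal (sqrt \<bar>Z x\<bar>) \<le>
      1 + ennreal (2 / (1 - cos 1)) * (\<Sum>n. ennreal (2 ^ n * (1 - cos (Z x / 4 ^ n))))" for x
  proof (cases "1 \<le> \<bar>Z x\<bar>")
    case True
    then show ?thesis using sqrt_le_cos_series[OF True] by (simp add: add_increasing)
  next
    case False
    then have "ennreal (sqrt \<bar>Z x\<bar>) \<le> 1" by (simp add: ennreal_le_1)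
    then show ?thesis by (rule order_trans) simp
  qed
  have "(\<integral>\<^sup>+ x. ennreal (2 ^ n * (1 - cos (Z x / 4 ^ n))) \<partial>M) =
      ennreal (2 ^ n * (\<integral>x. 1 - cos (Z x / 4 ^ n) \<partial>M))" for n
    using integrable_one_minus_cos[of "\<lambda>x. Z x / 4 ^ n"]
    by (subst nn_integral_eq_integral) (auto intro!: mult_nonneg_nonneg)
  note cos_int = this
  have "(\<integral>\<^sup>+ x. ennreal (sqrt \<bar>Z x\<bar>) \<partial>M) \<le> (\<integral>\<^sup>+ x. 1 + ennreal (2 / (1 - cos 1)) *
      (\<Sum>n. ennreal (2 ^ n * (1 - cos (Z x / 4 ^ n)))) \<partial>M)"
    by (intro nn_integral_mono pointwise)
  also have "\<dots> = (\<integral>\<^sup>+ x. 1 \<partial>M) + (\<integral>\<^sup>+ x. ennreal (2 / (1 - cos 1)) *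
      (\<Sum>n. ennreal (2 ^ n * (1 - cos (Z x / 4 ^ n)))) \<partial>M)"
    by (rule nn_integral_add) measurable
  also have "(\<integral>\<^sup>+ x. ennreal (2 / (1 - cos 1)) *
      (\<Sum>n. ennreal (2 ^ n * (1 - cos (Z x / 4 ^ n)))) \<partial>M) =
      ennreal (2 / (1 - cos 1)) * (\<integral>\<^sup>+ x. (\<Sum>n. ennreal (2 ^ n * (1 - cos (Z x / 4 ^ n)))) \<partial>M)"
    by (rule nn_integral_cmult) measurable
  also have "(\<integral>\<^sup>+ x. (\<Sum>n. ennreal (2 ^ n * (1 - cos (Z x / 4 ^ n)))) \<partial>M) =
      (\<Sum>n. ennreal (2 ^ n * (\<integral>x. 1 - cos (Z x / 4 ^ n) \<partial>M)))"
    unfolding cos_int[symmetric] by (rule nn_integral_suminf) measurable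
  finally show ?thesis by (simp only: nn_integral_const mult_1_left)
qed

lemma (in finite_measure) integrable_min_two:
  fixes f :: "'a \<Rightarrow> real"
  assumes [measurable]: "f \<in> borel_measurable M" and "\<And>x. 0 \<le> f x"
  shows "integrable M (\<lambda>x. min 2 (f x))"
proof (rule integrable_const_bound[where B = 2])
  show "AE x in M. norm (min 2 (f x)) \<le> 2"
    using assms(2) by (intro AE_I2) (simp add: abs_le_iff min_def order_trans[of "- 2" 0])
qed measurable

lemma (in finite_measure) min_series_le_sqrt_moment:
  fixes Z :: "'a \<Rightarrow> real"
  assumes [measurable]: "Z \<in> borel_measurable M"
  shows "(\<Sum>n. ennreal (2 ^ n * (\<integral>x. min 2 (\<bar>Z x\<bar> / 4 ^ n) \<partial>M))) \<le>
    6 * (emeasure M (space M) + (\<integral>\<^sup>+ x. ennreal (sqrt \<bar>Z x\<bar>) \<partial>M))"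
proof -
  have min_int: "ennreal (2 ^ n * (\<integral>x. min 2 (\<bar>Z x\<bar> / 4 ^ n) \<partial>M)) =
      (\<integral>\<^sup>+ x. ennreal (2 ^ n * min 2 (\<bar>Z x\<bar> / 4 ^ n)) \<partial>M)" for n
  proof -
    have "integrable M (\<lambda>x. min 2 (\<bar>Z x\<bar> / 4 ^ n))"
      by (rule integrable_min_two) auto
    then have "integrable M (\<lambda>x. 2 ^ n * min 2 (\<bar>Z x\<bar> / 4 ^ n))" by (rule integrable_mult_right)
    then have "(\<integral>\<^sup>+ x. ennreal (2 ^ n * min 2 (\<bar>Z x\<bar> / 4 ^ n)) \<partial>M) =
        ennreal (\<integral>x. 2 ^ n * min 2 (\<bar>Z x\<bar> / 4 ^ n) \<partial>M)"
      by (intro nn_integral_eq_integral AE_I2 mult_nonneg_nonneg) auto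
    then show ?thesis by (simp only: integral_mult_right_zero)
  qed
  have "(\<Sum>n. ennreal (2 ^ n * (\<integral>x. min 2 (\<bar>Z x\<bar> / 4 ^ n) \<partial>M))) =
      (\<integral>\<^sup>+ x. (\<Sum>n. ennreal (2 ^ n * min 2 (\<bar>Z x\<bar> / 4 ^ n))) \<partial>M)"
    unfolding min_int by (rule nn_integral_suminf[symmetric]) measurable
  also have "\<dots> \<le> (\<integral>\<^sup>+ x. 6 * (1 + ennreal (sqrt \<bar>Z x\<bar>)) \<partial>M)"
  proof (intro nn_integral_mono)
    fix x
    have "6 * (1 + ennreal (sqrt \<bar>Z x\<bar>)) = ennreal (6 * (1 + sqrt \<bar>Z x\<bar>))"
      by (simp only: ennreal_mult ennreal_plus ennreal_1 ennreal_numeral real_sqrt_ge_zero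
          abs_ge_zero zero_le_numeral zero_le_one add_nonneg_nonneg)
    then show "(\<Sum>n. ennreal (2 ^ n * min 2 (\<bar>Z x\<bar> / 4 ^ n))) \<le> 6 * (1 + ennreal (sqrt \<bar>Z x\<bar>))"
      using min_series_le_sqrt[OF abs_ge_zero[of "Z x"]] by (rule ord_le_eq_trans[OF _ sym, rotated])
  qed
  also have "\<dots> = 6 * (\<integral>\<^sup>+ x. 1 + ennreal (sqrt \<bar>Z x\<bar>) \<partial>M)"
    by (rule nn_integral_cmult) measurable
  also have "(\<integral>\<^sup>+ x. 1 + ennreal (sqrt \<bar>Z x\<bar>) \<partial>M) =
      (\<integral>\<^sup>+ x. 1 \<partial>M) + (\<integral>\<^sup>+ x. ennreal (sqrt \<bar>Z x\<bar>) \<partial>M)"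
    by (rule nn_integral_add) measurable
  finally show ?thesis by (simp only: nn_integral_const mult_1_left)
qed

section \<open>Characteristic functions and large jumps\<close>

lemma cmod_iexp_minus_one_le: "cmod (iexp t - 1) \<le> min 2 \<bar>t\<bar>"
proof -
  have "cmod (iexp t - 1) \<le> cmod (iexp t) + cmod 1" by (rule norm_triangle_ineq4)
  moreover have "cmod (iexp t - 1) \<le> \<bar>t\<bar>" using iexp_approx1[of t 0] by simp
  ultimately show ?thesis by simp
qed

text \<open>Damping and rotation are estimated separately: the real part of the exponent costs
\<open>1 - exp (Re z)\<close>, and the imaginary part costs \<open>1 - cos (Im z)\<close>.\<close>

lemma one_minus_Re_exp_le:
  assumes "Re z \<le> 0"
  shows "1 - Re (exp z) \<le> 2 * cmod z"
proof -
  have "1 - Re (exp z) = (1 - exp (Re z)) + exp (Re z) * (1 - cos (Im z))"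
    by (simp add: Re_exp algebra_simps)
  also have "1 - exp (Re z) \<le> cmod z"
    using exp_ge_add_one_self[of "Re z"] abs_Re_le_cmod[of z] by linarith
  also have "exp (Re z) * (1 - cos (Im z)) \<le> 1 * \<bar>Im z\<bar>"
    using assms one_minus_cos_le_min[of "Im z"] by (intro mult_mono) auto
  also have "1 * \<bar>Im z\<bar> \<le> cmod z" using abs_Im_le_cmod[of z] by simp
  finally show ?thesis by simp
qed

text \<open>Write the characteristic function of \<open>X 1\<close> as \<open>exp \<psi>\<close>, and let \<open>R\<close> be the Levy measure
restricted to jumps larger than \<open>1\<close>. The Gaussian part and the small jumps can only lower \<open>Re \<psi>\<close>, so \<open>- Re \<psi>\<close> is at least the contribution of \<open>R\<close>; together with
\<open>1 - Re (exp \<psi>) \<ge> 1 - exp (Re \<psi>)\<close> this gives the lower bound, where the exponential factor is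
the price for inverting \<open>r \<mapsto> 1 - exp (- r)\<close> on a bounded range. In the other direction
\<open>1 - Re (exp \<psi>) \<le> 2 * cmod \<psi>\<close>, and drift, Gaussian part and small jumps contribute at most
a multiple of \<open>norm w\<close> to \<open>\<psi>\<close> as long as \<open>norm w \<le> 1\<close>.\<close>

lemma levy_characteristic_function_bounds:
  fixes X :: "real \<Rightarrow> 'a \<Rightarrow> real ^ 'd::finite"
  assumes M: "prob_space M" and X[measurable]: "X 1 \<in> borel_measurable M"
    and F: "levy_measure_of M X F"
  defines "R \<equiv> density F (indicator {x. 1 < norm x})"
  shows levy_big_jumps_finite: "finite_measure R"
    and levy_big_jumps_le: "(\<integral>x. 1 - cos (w \<bullet> x) \<partial>R) \<le>
          exp (2 * measure R (space R)) * (\<integral>\<omega>. 1 - cos (w \<bullet> X 1 \<omega>) \<partial>M)"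
    and levy_char_fun_le: "\<exists>K\<ge>0. \<forall>w. norm w \<le> 1 \<longrightarrow> (\<integral>\<omega>. 1 - cos (w \<bullet> X 1 \<omega>) \<partial>M) \<le>
          2 * (K * norm w + (\<integral>x. min 2 (norm w * norm x) \<partial>R))"
proof -
  interpret prob_space M by fact
  have sF[measurable_cong]: "sets F = sets borel"
    and fin: "(\<integral>\<^sup>+ x. ennreal (min 1 ((norm x)\<^sup>2)) \<partial>F) < \<infinity>"
    using F by (auto simp: levy_measure_of_def)
  from F obtain \<gamma> Q where Q: "\<And>u. 0 \<le> u \<bullet> (Q *v u)" and
    lk: "\<And>u. (CLINT \<omega>|M. iexp (u \<bullet> X 1 \<omega>)) =
           exp (\<i> * complex_of_real (u \<bullet> \<gamma>) - complex_of_real (u \<bullet> (Q *v u)) / 2 +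
             (CLINT x|F. (iexp (u \<bullet> x) - 1
                - \<i> * complex_of_real ((u \<bullet> x) * indicator (cball 0 1) x))))"
    unfolding levy_measure_of_def by blast
  define A where "A = {x :: real ^ 'd. 1 < norm x}"
  have A[measurable]: "A \<in> sets borel" unfolding A_def by measurable
  have AF[measurable]: "A \<in> sets F" by (simp add: sF)
  have ind: "(indicator {x. 1 < norm x} :: real ^ 'd \<Rightarrow> ennreal) = (\<lambda>x. ennreal (indicator A x))"
    by (auto simp: A_def indicator_def fun_eq_iff)
  have setsR[measurable_cong]: "sets R = sets borel" by (simp add: R_def sF)
  have "emeasure F A = (\<integral>\<^sup>+ x. indicator A x \<partial>F)" by simp
  also have "\<dots> \<le> (\<integral>\<^sup>+ x. ennreal (min 1 ((norm x)\<^sup>2)) \<partial>F)"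
    by (intro nn_integral_mono) (auto simp: A_def indicator_def power_mono one_le_power min_def)
  finally have finA: "emeasure F A < \<infinity>" using fin by (rule le_less_trans)
  have emR: "emeasure R (space R) = emeasure F A"
    unfolding R_def A_def[symmetric] using sets_eq_imp_space_eq[OF sF]
    by (subst emeasure_density) auto
  show finR: "finite_measure R"
    by (rule finite_measureI) (use emR finA in auto)
  interpret R: finite_measure R by fact
  have intR: "(\<integral>x. g x \<partial>R) = (\<integral>x. indicator A x * g x \<partial>F)"
    and intR': "integrable R g \<longleftrightarrow> integrable F (\<lambda>x. indicator A x * g x)"
    if [measurable]: "g \<in> borel_measurable borel" for g :: "real ^ 'd \<Rightarrow> real"
    unfolding R_def ind by (auto simp: integral_density integrable_density)
  have int\<nu>: "integrable F (\<lambda>x. min 1 ((norm x)\<^sup>2))"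
    using fin by (intro integrableI_nonneg) auto
  \<comment> \<open>The integrand of the exponent is quadratic in the jump where the compensator acts and bounded elsewhere.\<close>
  define q where "q w x = iexp (w \<bullet> x) - 1 - \<i> * complex_of_real ((w \<bullet> x) * indicator (cball 0 1) x)"
    for w x :: "real ^ 'd"
  have [measurable]: "cball (0 :: real ^ 'd) 1 \<in> sets borel" by simp
  have q_meas[measurable]: "q w \<in> borel_measurable borel" for w unfolding q_def by measurable
  have q_le: "cmod (q w x) \<le> (norm w)\<^sup>2 * min 1 ((norm x)\<^sup>2) + indicator A x * min 2 (norm w * norm x)" for w x
  proof (cases "x \<in> A")
    case True
    then have "cmod (q w x) = cmod (iexp (w \<bullet> x) - 1)" by (simp add: q_def A_def)
    also have "\<dots> \<le> min 2 \<bar>w \<bullet> x\<bar>" by (rule cmod_iexp_minus_one_le)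
    also have "\<dots> \<le> min 2 (norm w * norm x)"
      using Cauchy_Schwarz_ineq2[of w x] by (intro min.mono) auto
    finally show ?thesis using True by (simp add: add_increasing)
  next
    case False
    then have x: "norm x \<le> 1" by (simp add: A_def)
    have "cmod (q w x) \<le> \<bar>w \<bullet> x\<bar>\<^sup>2 / 2"
      using iexp_approx1[of "w \<bullet> x" 1] x by (simp add: q_def power2_eq_square algebra_simps)
    also have "\<dots> \<le> (norm w * norm x)\<^sup>2 / 2"
      using Cauchy_Schwarz_ineq2[of w x] by (intro divide_right_mono power_mono) auto
    also have "\<dots> \<le> (norm w)\<^sup>2 * (norm x)\<^sup>2" by (simp add: power_mult_distrib)
    also have "(norm x)\<^sup>2 = min 1 ((norm x)\<^sup>2)" using x by (simp add: min_absorb2 power_le_one)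
    finally show ?thesis using False by simp
  qed
  have int_min: "integrable F (\<lambda>x. indicator A x * min 2 (norm w * norm x))" for w :: "real ^ 'd"
    by (subst intR'[symmetric]) (auto intro!: R.integrable_const_bound[where B = 2])
  have q_bound_int: "integrable F (\<lambda>x. (norm w)\<^sup>2 * min 1 ((norm x)\<^sup>2) + indicator A x * min 2 (norm w * norm x))"
    for w :: "real ^ 'd"
    using int\<nu> int_min by auto
  have q_int: "integrable F (q w)" for w
  proof (rule Bochner_Integration.integrable_bound[OF q_bound_int[of w]])
    show "AE x in F. norm (q w x) \<le> norm ((norm w)\<^sup>2 * min 1 ((norm x)\<^sup>2) + indicator A x * min 2 (norm w * norm x))"
      using q_le by (intro AE_I2) (metis abs_ge_self order_trans real_norm_def)
  qed measurable
  define \<psi> where "\<psi> w = \<i> * complex_of_real (w \<bullet> \<gamma>) - complex_of_real (w \<bullet> (Q *v w)) / 2 + integral\<^sup>L F (q w)" for w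
  have Re\<psi>: "Re (\<psi> w) = - ((w \<bullet> (Q *v w)) / 2) - (\<integral>x. 1 - cos (w \<bullet> x) \<partial>F)" for w
  proof -
    have "Re (integral\<^sup>L F (q w)) = (\<integral>x. Re (q w x) \<partial>F)"
      using q_int by simp
    also have "\<dots> = (\<integral>x. - (1 - cos (w \<bullet> x)) \<partial>F)" by (simp add: q_def Re_exp)
    finally show ?thesis unfolding integral_minus by (simp add: \<psi>_def)
  qed
  have int_cos: "integrable F (\<lambda>x. 1 - cos (w \<bullet> x))" for w
  proof -
    have "integrable F (\<lambda>x. - Re (q w x))"
      using q_int[of w] by simp
    then show ?thesis by (simp add: q_def Re_exp)
  qed
  have Re_le: "Re (\<psi> w) \<le> - (\<integral>x. 1 - cos (w \<bullet> x) \<partial>R)" for w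
  proof -
    have "(\<integral>x. 1 - cos (w \<bullet> x) \<partial>R) = (\<integral>x. indicator A x * (1 - cos (w \<bullet> x)) \<partial>F)"
      by (rule intR) simp
    also have "\<dots> \<le> (\<integral>x. 1 - cos (w \<bullet> x) \<partial>F)"
      using R.integrable_one_minus_cos[of "\<lambda>x. w \<bullet> x"] int_cos[of w]
      by (intro integral_mono iffD1[OF intR']) (auto simp: indicator_def)
    finally show ?thesis using Q[of w] by (simp add: Re\<psi>)
  qed
  have R_nonneg: "0 \<le> (\<integral>x. 1 - cos (w \<bullet> x) \<partial>R)" for w :: "real ^ 'd"
    by (intro integral_nonneg_AE) simp
  have phi: "(\<integral>\<omega>. 1 - cos (w \<bullet> X 1 \<omega>) \<partial>M) = 1 - Re (exp (\<psi> w))" for w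
  proof -
    have int: "integrable M (\<lambda>\<omega>. iexp (w \<bullet> X 1 \<omega>))"
      by (intro integrable_const_bound[where B = 1]) auto
    then have "Re (CLINT \<omega>|M. iexp (w \<bullet> X 1 \<omega>)) = (\<integral>\<omega>. cos (w \<bullet> X 1 \<omega>) \<partial>M)"
      by (subst integral_Re[symmetric]) (simp_all add: Re_exp)
    moreover have "integrable M (\<lambda>\<omega>. cos (w \<bullet> X 1 \<omega>))"
      by (intro integrable_const_bound[where B = 1]) auto
    ultimately show ?thesis
      using lk[of w] by (simp add: \<psi>_def q_def[abs_def] prob_space)
  qed

  show "(\<integral>x. 1 - cos (w \<bullet> x) \<partial>R) \<le>
      exp (2 * measure R (space R)) * (\<integral>\<omega>. 1 - cos (w \<bullet> X 1 \<omega>) \<partial>M)" for w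
  proof -
    let ?\<rho> = "\<integral>x. 1 - cos (w \<bullet> x) \<partial>R"
    have "?\<rho> \<le> (\<integral>x. 2 \<partial>R)"
    proof (intro integral_mono R.integrable_one_minus_cos)
      show "1 - cos (w \<bullet> x) \<le> 2" for x
        using cos_ge_minus_one[of "w \<bullet> x"] by linarith
    qed auto
    then have \<rho>: "?\<rho> \<le> 2 * measure R (space R)" by (simp add: mult.commute)
    have "Re (exp (\<psi> w)) \<le> exp (- ?\<rho>)"
      using complex_Re_le_cmod[of "exp (\<psi> w)"] Re_le[of w] by (simp add: order_trans)
    then have "1 - exp (- ?\<rho>) \<le> (\<integral>\<omega>. 1 - cos (w \<bullet> X 1 \<omega>) \<partial>M)" by (simp add: phi)
    \<comment> \<open>Inverting \<open>r \<mapsto> 1 - exp (- r)\<close> costs a factor \<open>exp r\<close>, which is bounded as \<open>R\<close> is finite.\<close>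
    have "exp ?\<rho> * (1 - exp (- ?\<rho>)) = exp ?\<rho> - 1"
      by (simp add: right_diff_distrib exp_minus)
    moreover have "1 + ?\<rho> \<le> exp ?\<rho>" by (rule exp_ge_add_one_self)
    ultimately have "?\<rho> \<le> exp ?\<rho> * (1 - exp (- ?\<rho>))" by linarith
    also have "\<dots> \<le> exp (2 * measure R (space R)) * (1 - exp (- ?\<rho>))"
      using \<rho> R_nonneg[of w] by (intro mult_right_mono) auto
    also have "\<dots> \<le> exp (2 * measure R (space R)) * (\<integral>\<omega>. 1 - cos (w \<bullet> X 1 \<omega>) \<partial>M)"
      by (intro mult_left_mono exp_ge_zero) fact
    finally show ?thesis .
  qed

  let ?\<nu> = "\<integral>x. min 1 ((norm x)\<^sup>2) \<partial>F"
  define K where "K = norm \<gamma> + onorm ((*v) Q) + ?\<nu>"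
  have \<nu>0: "0 \<le> ?\<nu>" by (intro integral_nonneg_AE) simp
  have o0: "0 \<le> onorm ((*v) Q)" by (intro onorm_pos_le matrix_vector_mul_bounded_linear)
  have "(\<integral>\<omega>. 1 - cos (w \<bullet> X 1 \<omega>) \<partial>M) \<le> 2 * (K * norm w + (\<integral>x. min 2 (norm w * norm x) \<partial>R))"
    if w: "norm w \<le> 1" for w
  proof -
    have sq: "(norm w)\<^sup>2 \<le> norm w" using w by (simp add: power2_eq_square mult_left_le)
    have "Re (\<psi> w) \<le> 0" using Re_le[of w] R_nonneg[of w] by linarith
    then have "(\<integral>\<omega>. 1 - cos (w \<bullet> X 1 \<omega>) \<partial>M) \<le> 2 * cmod (\<psi> w)"
      unfolding phi by (rule one_minus_Re_exp_le)
    also have "cmod (\<psi> w) \<le> \<bar>w \<bullet> \<gamma>\<bar> + (w \<bullet> (Q *v w)) / 2 + cmod (integral\<^sup>L F (q w))"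
      unfolding \<psi>_def
      by (rule order_trans[OF norm_triangle_ineq] add_right_mono order_trans[OF norm_triangle_ineq4])+
        (use Q in \<open>simp add: norm_mult\<close>)
    also have "\<bar>w \<bullet> \<gamma>\<bar> \<le> norm \<gamma> * norm w" using Cauchy_Schwarz_ineq2[of w \<gamma>] by (simp add: mult.commute)
    also have "(w \<bullet> (Q *v w)) / 2 \<le> onorm ((*v) Q) * norm w"
    proof -
      have "w \<bullet> (Q *v w) \<le> norm w * norm (Q *v w)" by (rule norm_cauchy_schwarz)
      also have "\<dots> \<le> norm w * (onorm ((*v) Q) * norm w)"
        by (intro mult_left_mono onorm matrix_vector_mul_bounded_linear) auto
      also have "\<dots> = onorm ((*v) Q) * (norm w)\<^sup>2" by (simp add: power2_eq_square)
      also have "\<dots> \<le> onorm ((*v) Q) * norm w" using sq o0 by (rule mult_left_mono)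
      finally show ?thesis using Q[of w] by simp
    qed
    also have "cmod (integral\<^sup>L F (q w)) \<le> (\<integral>x. cmod (q w x) \<partial>F)" by (rule integral_norm_bound)
    also have "\<dots> \<le> (\<integral>x. (norm w)\<^sup>2 * min 1 ((norm x)\<^sup>2) + indicator A x * min 2 (norm w * norm x) \<partial>F)"
      using q_int q_bound_int q_le by (intro integral_mono integrable_norm) auto
    also have "\<dots> = (norm w)\<^sup>2 * ?\<nu> + (\<integral>x. min 2 (norm w * norm x) \<partial>R)"
      using int\<nu> int_min[of w] by (simp add: intR)
    also have "(norm w)\<^sup>2 * ?\<nu> \<le> ?\<nu> * norm w" using mult_right_mono[OF sq \<nu>0] by (simp add: mult.commute)
    finally show ?thesis by (simp add: K_def algebra_simps)
  qed
  moreover have "0 \<le> K" using \<nu>0 o0 by (simp add: K_def)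
  ultimately show "\<exists>K\<ge>0. \<forall>w. norm w \<le> 1 \<longrightarrow> (\<integral>\<omega>. 1 - cos (w \<bullet> X 1 \<omega>) \<partial>M) \<le>
          2 * (K * norm w + (\<integral>x. min 2 (norm w * norm x) \<partial>R))" by blast
qed

section \<open>Square root moments of a Levy process\<close>

text \<open>This turns finiteness of a square root moment into a summability condition on the real part
of the characteristic function at the points \<open>1 / 4 ^ n\<close>. It is applied both to the law of
\<open>X 1\<close> and to the large jumps of the Levy measure.\<close>

lemma (in finite_measure) sqrt_moment_finite_iff_cos_series:
  fixes Z :: "'a \<Rightarrow> real"
  assumes [measurable]: "Z \<in> borel_measurable M"
  shows "(\<integral>\<^sup>+ x. ennreal (sqrt \<bar>Z x\<bar>) \<partial>M) < \<infinity> \<longleftrightarrow>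
    (\<Sum>n. ennreal (2 ^ n * (\<integral>x. 1 - cos (Z x / 4 ^ n) \<partial>M))) < \<infinity>"
proof
  assume fin: "(\<integral>\<^sup>+ x. ennreal (sqrt \<bar>Z x\<bar>) \<partial>M) < \<infinity>"
  have "(\<integral>x. 1 - cos (Z x / 4 ^ n) \<partial>M) \<le> (\<integral>x. min 2 (\<bar>Z x\<bar> / 4 ^ n) \<partial>M)" for n
  proof (rule integral_mono)
    show "integrable M (\<lambda>x. 1 - cos (Z x / 4 ^ n))" by (rule integrable_one_minus_cos) measurable
    show "integrable M (\<lambda>x. min 2 (\<bar>Z x\<bar> / 4 ^ n))"
      by (rule integrable_min_two) auto
    show "1 - cos (Z x / 4 ^ n) \<le> min 2 (\<bar>Z x\<bar> / 4 ^ n)" for x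
      using one_minus_cos_le_min[of "Z x / 4 ^ n"] by simp
  qed
  then have "(\<Sum>n. ennreal (2 ^ n * (\<integral>x. 1 - cos (Z x / 4 ^ n) \<partial>M))) \<le>
      (\<Sum>n. ennreal (2 ^ n * (\<integral>x. min 2 (\<bar>Z x\<bar> / 4 ^ n) \<partial>M)))"
    by (intro suminf_le ennreal_leI mult_left_mono summableI) auto
  also have "\<dots> \<le> 6 * (emeasure M (space M) + (\<integral>\<^sup>+ x. ennreal (sqrt \<bar>Z x\<bar>) \<partial>M))"
    by (rule min_series_le_sqrt_moment) measurable
  also have "\<dots> < \<infinity>"
    using fin emeasure_finite by (simp add: ennreal_mult_eq_top_iff less_top[symmetric])
  finally show "(\<Sum>n. ennreal (2 ^ n * (\<integral>x. 1 - cos (Z x / 4 ^ n) \<partial>M))) < \<infinity>" .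
next
  assume fin: "(\<Sum>n. ennreal (2 ^ n * (\<integral>x. 1 - cos (Z x / 4 ^ n) \<partial>M))) < \<infinity>"
  have "(\<integral>\<^sup>+ x. ennreal (sqrt \<bar>Z x\<bar>) \<partial>M) \<le> emeasure M (space M) +
      ennreal (2 / (1 - cos 1)) * (\<Sum>n. ennreal (2 ^ n * (\<integral>x. 1 - cos (Z x / 4 ^ n) \<partial>M)))"
    by (rule sqrt_moment_le_cos_series) measurable
  also have "\<dots> < \<infinity>"
  proof -
    have "a + ennreal c * s < \<infinity>" if "a < \<infinity>" "s < \<infinity>" for a s :: ennreal and c :: real
      using that by (simp add: ennreal_mult_less_top)
    then show ?thesis using fin emeasure_finite by (simp only: infinity_ennreal_def less_top)
  qed
  finally show "(\<integral>\<^sup>+ x. ennreal (sqrt \<bar>Z x\<bar>) \<partial>M) < \<infinity>" .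
qed

lemma sqrt_norm_le_sum_components:
  fixes x :: "real ^ 'd::finite"
  shows "sqrt (norm x) \<le> (\<Sum>j\<in>UNIV. sqrt \<bar>x $ j\<bar>)"
proof -
  have "sqrt (\<Sum>j\<in>A. \<bar>x $ j\<bar>) \<le> (\<Sum>j\<in>A. sqrt \<bar>x $ j\<bar>)" if "finite A" for A
    using that
  proof induction
    case (insert j A)
    have "sqrt (\<bar>x $ j\<bar> + (\<Sum>j\<in>A. \<bar>x $ j\<bar>)) \<le> sqrt \<bar>x $ j\<bar> + sqrt (\<Sum>j\<in>A. \<bar>x $ j\<bar>)"
      by (intro sqrt_add_le_add_sqrt sum_nonneg) auto
    with insert show ?case by simp
  qed simp
  then show ?thesis
    using real_sqrt_le_mono[OF norm_le_l1_cart[of x]] by (meson finite order_trans)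
qed

lemma sqrt_norm_moment_finite_iff_components:
  fixes Z :: "'a \<Rightarrow> real ^ 'd::finite"
  assumes [measurable]: "Z \<in> borel_measurable M"
  shows "(\<integral>\<^sup>+ x. ennreal (sqrt (norm (Z x))) \<partial>M) < \<infinity> \<longleftrightarrow>
    (\<forall>j. (\<integral>\<^sup>+ x. ennreal (sqrt \<bar>Z x $ j\<bar>) \<partial>M) < \<infinity>)"
proof
  assume "(\<integral>\<^sup>+ x. ennreal (sqrt (norm (Z x))) \<partial>M) < \<infinity>"
  then show "\<forall>j. (\<integral>\<^sup>+ x. ennreal (sqrt \<bar>Z x $ j\<bar>) \<partial>M) < \<infinity>"
    by (intro allI) (erule le_less_trans[rotated],
      intro nn_integral_mono ennreal_leI real_sqrt_le_mono component_le_norm_cart)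
next
  assume fin: "\<forall>j. (\<integral>\<^sup>+ x. ennreal (sqrt \<bar>Z x $ j\<bar>) \<partial>M) < \<infinity>"
  have "(\<integral>\<^sup>+ x. ennreal (sqrt (norm (Z x))) \<partial>M) \<le> (\<integral>\<^sup>+ x. (\<Sum>j\<in>UNIV. ennreal (sqrt \<bar>Z x $ j\<bar>)) \<partial>M)"
    by (intro nn_integral_mono) (subst sum_ennreal, simp, intro ennreal_leI sqrt_norm_le_sum_components)
  also have "\<dots> = (\<Sum>j\<in>UNIV. \<integral>\<^sup>+ x. ennreal (sqrt \<bar>Z x $ j\<bar>) \<partial>M)"
    by (rule nn_integral_sum) measurable
  also have "\<dots> < \<infinity>" using fin by simp
  finally show "(\<integral>\<^sup>+ x. ennreal (sqrt (norm (Z x))) \<partial>M) < \<infinity>" .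
qed

text \<open>Evaluate the bounds on the characteristic function at \<open>w = axis j (1 / 4 ^ n)\<close> and sum with
the weights \<open>2 ^ n\<close>. The error linear in \<open>norm w\<close> becomes a convergent geometric series, so
the cosine series of the law and those of the large jumps are finite together.\<close>

lemma levy_sqrt_moment_iff:
  fixes X :: "real \<Rightarrow> 'a \<Rightarrow> real ^ 'd::finite"
  assumes M: "prob_space M" and X[measurable]: "X 1 \<in> borel_measurable M"
    and F: "levy_measure_of M X F"
  shows "integrable M (\<lambda>\<omega>. sqrt (norm (X 1 \<omega>))) \<longleftrightarrow>
    (\<integral>\<^sup>+ \<theta>\<in>{\<theta>. 1 < norm \<theta>}. ennreal (sqrt (norm \<theta>)) \<partial>F) < \<infinity>"
proof -
  interpret prob_space M by fact
  define R where "R = density F (indicator {x. 1 < norm x})"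
  interpret R: finite_measure R
    unfolding R_def by (rule levy_big_jumps_finite[OF M X F])
  have sF[measurable_cong]: "sets F = sets borel" using F by (simp add: levy_measure_of_def)
  then have [measurable_cong]: "sets R = sets borel" by (simp add: R_def)
  define S_M where "S_M j = (\<Sum>n. ennreal (2 ^ n * (\<integral>\<omega>. 1 - cos (X 1 \<omega> $ j / 4 ^ n) \<partial>M)))" for j
  define S_R where "S_R j = (\<Sum>n. ennreal (2 ^ n * (\<integral>x. 1 - cos (x $ j / 4 ^ n) \<partial>R)))" for j :: 'd
  have axis_inner: "axis j (1 / 4 ^ n) \<bullet> x = x $ j / 4 ^ n" for j :: 'd and n :: nat and x :: "real ^ 'd"
    by (simp add: inner_axis')
  have axis_norm: "norm (axis j (1 / 4 ^ n :: real) :: real ^ 'd) = 1 / 4 ^ n" for j and n :: nat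
    by (simp add: norm_eq_sqrt_inner inner_axis_axis real_sqrt_divide)

  have M_iff: "integrable M (\<lambda>\<omega>. sqrt (norm (X 1 \<omega>))) \<longleftrightarrow> (\<forall>j. S_M j < \<infinity>)"
  proof -
    have "integrable M (\<lambda>\<omega>. sqrt (norm (X 1 \<omega>))) \<longleftrightarrow> (\<integral>\<^sup>+ \<omega>. ennreal (sqrt (norm (X 1 \<omega>))) \<partial>M) < \<infinity>"
      by (subst integrable_iff_bounded) simp
    also have "\<dots> \<longleftrightarrow> (\<forall>j. (\<integral>\<^sup>+ \<omega>. ennreal (sqrt \<bar>X 1 \<omega> $ j\<bar>) \<partial>M) < \<infinity>)"
      by (rule sqrt_norm_moment_finite_iff_components) measurable
    also have "\<dots> \<longleftrightarrow> (\<forall>j. S_M j < \<infinity>)"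
      unfolding S_M_def by (intro all_cong1 sqrt_moment_finite_iff_cos_series) measurable
    finally show ?thesis .
  qed
  have R_eq: "(\<integral>\<^sup>+ \<theta>\<in>{\<theta>. 1 < norm \<theta>}. ennreal (sqrt (norm \<theta>)) \<partial>F) = (\<integral>\<^sup>+ x. ennreal (sqrt (norm x)) \<partial>R)"
    unfolding R_def by (subst nn_integral_density) (auto simp: sF mult.commute)
  have R_iff: "(\<integral>\<^sup>+ \<theta>\<in>{\<theta>. 1 < norm \<theta>}. ennreal (sqrt (norm \<theta>)) \<partial>F) < \<infinity> \<longleftrightarrow> (\<forall>j. S_R j < \<infinity>)"
  proof -
    have "(\<integral>\<^sup>+ x. ennreal (sqrt (norm x)) \<partial>R) < \<infinity> \<longleftrightarrow> (\<forall>j. (\<integral>\<^sup>+ x. ennreal (sqrt \<bar>x $ j\<bar>) \<partial>R) < \<infinity>)"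
      by (rule sqrt_norm_moment_finite_iff_components) measurable
    also have "\<dots> \<longleftrightarrow> (\<forall>j. S_R j < \<infinity>)"
      unfolding S_R_def by (intro all_cong1 R.sqrt_moment_finite_iff_cos_series) measurable
    finally show ?thesis unfolding R_eq .
  qed

  have S_R_le: "S_R j \<le> ennreal (exp (2 * measure R (space R))) * S_M j" for j
  proof -
    have "ennreal (2 ^ n * (\<integral>x. 1 - cos (x $ j / 4 ^ n) \<partial>R)) \<le>
        ennreal (exp (2 * measure R (space R))) * ennreal (2 ^ n * (\<integral>\<omega>. 1 - cos (X 1 \<omega> $ j / 4 ^ n) \<partial>M))" for n
    proof -
      have "(\<integral>x. 1 - cos (x $ j / 4 ^ n) \<partial>R) \<le>
          exp (2 * measure R (space R)) * (\<integral>\<omega>. 1 - cos (X 1 \<omega> $ j / 4 ^ n) \<partial>M)"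
        using levy_big_jumps_le[OF M X F, of "axis j (1 / 4 ^ n)"] by (simp only: axis_inner R_def)
      then have "2 ^ n * (\<integral>x. 1 - cos (x $ j / 4 ^ n) \<partial>R) \<le>
          2 ^ n * (exp (2 * measure R (space R)) * (\<integral>\<omega>. 1 - cos (X 1 \<omega> $ j / 4 ^ n) \<partial>M))"
        by (rule mult_left_mono) simp
      then show ?thesis
        by (subst ennreal_mult'[symmetric]) (auto intro!: ennreal_leI simp: mult_ac)
    qed
    then show ?thesis
      unfolding S_R_def S_M_def ennreal_suminf_cmult[symmetric] by (intro suminf_le summableI)
  qed

  have S_M_finite: "S_M j < \<infinity>" if fin: "(\<integral>\<^sup>+ x. ennreal (sqrt (norm x)) \<partial>R) < \<infinity>" for j
  proof -
    obtain K where K: "0 \<le> K" "\<And>w. norm w \<le> 1 \<Longrightarrow> (\<integral>\<omega>. 1 - cos (w \<bullet> X 1 \<omega>) \<partial>M) \<le>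
        2 * (K * norm w + (\<integral>x. min 2 (norm w * norm x) \<partial>R))"
      using levy_char_fun_le[OF M X F] unfolding R_def by blast
    have "ennreal (2 ^ n * (\<integral>\<omega>. 1 - cos (X 1 \<omega> $ j / 4 ^ n) \<partial>M)) \<le>
        ennreal (2 * K) * ennreal ((1 / 2) ^ n) + 2 * ennreal (2 ^ n * (\<integral>x. min 2 (\<bar>norm x\<bar> / 4 ^ n) \<partial>R))" for n
    proof -
      let ?I = "\<integral>x. min 2 (\<bar>norm x\<bar> / 4 ^ n) \<partial>R"
      have I0: "0 \<le> ?I" by (intro integral_nonneg_AE) simp
      have "(\<integral>\<omega>. 1 - cos (X 1 \<omega> $ j / 4 ^ n) \<partial>M) \<le> 2 * (K / 4 ^ n + ?I)"
        using K(2)[of "axis j (1 / 4 ^ n)"] by (simp add: axis_inner axis_norm)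
      then have "2 ^ n * (\<integral>\<omega>. 1 - cos (X 1 \<omega> $ j / 4 ^ n) \<partial>M) \<le> 2 ^ n * (2 * (K / 4 ^ n + ?I))"
        by (rule mult_left_mono) simp
      also have "\<dots> = (2 * K) * (1 / 2) ^ n + 2 * (2 ^ n * ?I)"
      proof -
        have "2 ^ n / 4 ^ n = (1 / 2 :: real) ^ n" by (simp flip: power_divide)
        moreover have "2 ^ n * (2 * (K / 4 ^ n + ?I)) = (2 * K) * (2 ^ n / 4 ^ n) + 2 * (2 ^ n * ?I)"
          by (simp add: distrib_left)
        ultimately show ?thesis by (simp only:)
      qed
      finally have "ennreal (2 ^ n * (\<integral>\<omega>. 1 - cos (X 1 \<omega> $ j / 4 ^ n) \<partial>M)) \<le>
          ennreal ((2 * K) * (1 / 2) ^ n + 2 * (2 ^ n * ?I))"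
        by (rule ennreal_leI)
      also have "\<dots> = ennreal ((2 * K) * (1 / 2) ^ n) + ennreal (2 * (2 ^ n * ?I))"
        using K(1) I0 by (intro ennreal_plus mult_nonneg_nonneg) auto
      also have "ennreal ((2 * K) * (1 / 2) ^ n) = ennreal (2 * K) * ennreal ((1 / 2) ^ n)"
        using K(1) by (intro ennreal_mult) auto
      also have "ennreal (2 * (2 ^ n * ?I)) = ennreal 2 * ennreal (2 ^ n * ?I)"
        using I0 by (intro ennreal_mult mult_nonneg_nonneg) auto
      finally show ?thesis by (simp only: ennreal_numeral)
    qed
    then have "S_M j \<le> (\<Sum>n. ennreal (2 * K) * ennreal ((1 / 2) ^ n) + 2 * ennreal (2 ^ n * (\<integral>x. min 2 (\<bar>norm x\<bar> / 4 ^ n) \<partial>R)))"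
      unfolding S_M_def by (intro suminf_le summableI)
    also have "\<dots> = ennreal (2 * K) * (\<Sum>n. ennreal ((1 / 2) ^ n)) +
        2 * (\<Sum>n. ennreal (2 ^ n * (\<integral>x. min 2 (\<bar>norm x\<bar> / 4 ^ n) \<partial>R)))"
      by (simp only: suminf_add[OF summableI summableI, symmetric] ennreal_suminf_cmult)
    also have "(\<Sum>n. ennreal ((1 / 2) ^ n)) = ennreal 2"
      using geometric_sums[of "1 / 2 :: real"] by (intro suminf_ennreal_eq) auto
    also have "ennreal (2 * K) * ennreal 2 + 2 * (\<Sum>n. ennreal (2 ^ n * (\<integral>x. min 2 (\<bar>norm x\<bar> / 4 ^ n) \<partial>R))) < \<infinity>"
    proof -
      have "(\<Sum>n. ennreal (2 ^ n * (\<integral>x. min 2 (\<bar>norm x\<bar> / 4 ^ n) \<partial>R))) \<le>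
          6 * (emeasure R (space R) + (\<integral>\<^sup>+ x. ennreal (sqrt \<bar>norm x\<bar>) \<partial>R))"
        by (rule R.min_series_le_sqrt_moment) measurable
      also have "\<dots> < \<infinity>"
        using fin R.emeasure_finite by (simp add: ennreal_mult_eq_top_iff less_top[symmetric])
      finally show ?thesis by (simp add: ennreal_mult_less_top)
    qed
    finally show ?thesis .
  qed

  show ?thesis
  proof
    assume "integrable M (\<lambda>\<omega>. sqrt (norm (X 1 \<omega>)))"
    then have "S_M j < \<infinity>" for j by (simp only: M_iff)
    then have "S_R j < \<infinity>" for j
      using le_less_trans[OF S_R_le[of j]] by (simp add: ennreal_mult_less_top)
    then show "(\<integral>\<^sup>+ \<theta>\<in>{\<theta>. 1 < norm \<theta>}. ennreal (sqrt (norm \<theta>)) \<partial>F) < \<infinity>" unfolding R_iff by blast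
  next
    assume "(\<integral>\<^sup>+ \<theta>\<in>{\<theta>. 1 < norm \<theta>}. ennreal (sqrt (norm \<theta>)) \<partial>F) < \<infinity>"
    then show "integrable M (\<lambda>\<omega>. sqrt (norm (X 1 \<omega>)))"
      using S_M_finite unfolding M_iff R_eq by blast
  qed
qed

section \<open>Moment growth of mean-zero Levy processes in Hilbert space\<close>

text \<open>Under the product law of \<open>(U, V)\<close> the inner product is linear in \<open>V\<close> once \<open>U\<close> is frozen, so
its integral over \<open>V\<close> is the inner product with the mean of \<open>V\<close>.\<close>

lemma (in prob_space) indep_var_inner_mean_zero:
  fixes U V :: "'a \<Rightarrow> 'h::{real_inner, banach, second_countable_topology}"
  assumes indep: "indep_var borel U borel V"
    and U: "integrable M U" "integrable M (\<lambda>\<omega>. (norm (U \<omega>))\<^sup>2)"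
    and V: "integrable M V" "integrable M (\<lambda>\<omega>. (norm (V \<omega>))\<^sup>2)"
    and zero: "expectation V = 0"
  shows "integrable M (\<lambda>\<omega>. U \<omega> \<bullet> V \<omega>)" and "expectation (\<lambda>\<omega>. U \<omega> \<bullet> V \<omega>) = 0"
proof -
  have [measurable]: "U \<in> borel_measurable M" "V \<in> borel_measurable M" using U(1) V(1) by auto
  show int: "integrable M (\<lambda>\<omega>. U \<omega> \<bullet> V \<omega>)"
  proof (rule Bochner_Integration.integrable_bound)
    show "integrable M (\<lambda>\<omega>. (norm (U \<omega>))\<^sup>2 + (norm (V \<omega>))\<^sup>2)" using U(2) V(2) by auto
    have "\<bar>U \<omega> \<bullet> V \<omega>\<bar> \<le> (norm (U \<omega>))\<^sup>2 + (norm (V \<omega>))\<^sup>2" for \<omega>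
      using Cauchy_Schwarz_ineq2[of "U \<omega>" "V \<omega>"] sum_squares_bound[of "norm (U \<omega>)" "norm (V \<omega>)"]
        mult_nonneg_nonneg[of "norm (U \<omega>)" "norm (V \<omega>)"] by simp
    then show "AE \<omega> in M. norm (U \<omega> \<bullet> V \<omega>) \<le> norm ((norm (U \<omega>))\<^sup>2 + (norm (V \<omega>))\<^sup>2)" by simp
  qed measurable
  have eq: "distr M borel U \<Otimes>\<^sub>M distr M borel V = distr M (borel \<Otimes>\<^sub>M borel) (\<lambda>\<omega>. (U \<omega>, V \<omega>))"
    using indep by (simp add: indep_var_distribution_eq)
  interpret DU: prob_space "distr M borel U" by (rule prob_space_distr) simp
  interpret DV: prob_space "distr M borel V" by (rule prob_space_distr) simp
  interpret P: pair_prob_space "distr M borel U" "distr M borel V" ..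
  have meas: "(\<lambda>p. fst p \<bullet> snd p) \<in> borel_measurable (borel \<Otimes>\<^sub>M (borel :: 'h measure))" by measurable
  have "integrable (distr M borel U \<Otimes>\<^sub>M distr M borel V) (\<lambda>p. fst p \<bullet> snd p)"
    unfolding eq by (subst integrable_distr_eq) (use meas int in auto)
  note P.integral_fst'[OF this]
  moreover have "(\<integral>v. u \<bullet> v \<partial>distr M borel V) = 0" for u
    using V(1) zero by (simp add: integral_distr)
  moreover have "integral\<^sup>L (distr M borel U \<Otimes>\<^sub>M distr M borel V) (\<lambda>p. fst p \<bullet> snd p) =
      (\<integral>\<omega>. U \<omega> \<bullet> V \<omega> \<partial>M)"
    unfolding eq by (subst integral_distr) (use meas in auto)
  ultimately show "expectation (\<lambda>\<omega>. U \<omega> \<bullet> V \<omega>) = 0" by simp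
qed

context
  fixes M :: "'a measure" and Y :: "real \<Rightarrow> 'a \<Rightarrow> 'h::{real_inner, banach, second_countable_topology}"
  assumes M: "prob_space M" and levy: "cadlag_levy_process M Y"
    and int: "\<And>t. 0 \<le> t \<Longrightarrow> integrable M (Y t)"
    and int2: "\<And>t. 0 \<le> t \<Longrightarrow> integrable M (\<lambda>\<omega>. (norm (Y t \<omega>))\<^sup>2)"
    and zero: "\<And>t. 0 \<le> t \<Longrightarrow> integral\<^sup>L M (Y t) = 0"
begin

interpretation prob_space M by (rule M)

text \<open>Independent mean-zero increments are orthogonal, so their second moments add up; by
stationarity the second one has the law of \<open>Y t\<close>.\<close>

lemma levy_second_moment_add:
  assumes "0 \<le> s" "0 \<le> t"
  shows "(\<integral>\<omega>. (norm (Y (s + t) \<omega>))\<^sup>2 \<partial>M) = (\<integral>\<omega>. (norm (Y s \<omega>))\<^sup>2 \<partial>M) + (\<integral>\<omega>. (norm (Y t \<omega>))\<^sup>2 \<partial>M)"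
proof -
  have [measurable]: "Y r \<in> borel_measurable M" if "0 \<le> r" for r
    using int[OF that] by auto
  have Y0: "AE \<omega> in M. Y 0 \<omega> = 0" using levy by (simp add: cadlag_levy_process_def)
  have m0: "(\<integral>\<omega>. (norm (Y 0 \<omega>))\<^sup>2 \<partial>M) = 0"
    using Y0 by (intro integral_eq_zero_AE) auto
  consider "s = 0" | "t = 0" | "0 < s" "0 < t" using assms by linarith
  then show ?thesis
  proof cases
    case 3
    define U where "U \<omega> = Y s \<omega> - Y 0 \<omega>" for \<omega>
    define V where "V \<omega> = Y (s + t) \<omega> - Y s \<omega>" for \<omega>
    \<comment> \<open>The two increments over \<open>0 < s < s + t\<close>; only the first three time points matter.\<close>
    define \<tau> where "\<tau> i = (if i = 0 then 0 else if i = 1 then s else s + t)" for i :: nat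
    have [measurable]: "Y 0 \<in> borel_measurable M" "Y s \<in> borel_measurable M" "Y (s + t) \<in> borel_measurable M" "Y t \<in> borel_measurable M"
      using 3 by auto
    have "\<forall>i<2. \<tau> i < \<tau> (Suc i)" using 3 by (auto simp: \<tau>_def less_2_cases_iff)
    moreover have "0 \<le> \<tau> 0" by (simp add: \<tau>_def)
    ultimately have iv: "indep_vars (\<lambda>_. borel) (\<lambda>i \<omega>. Y (\<tau> (Suc i)) \<omega> - Y (\<tau> i) \<omega>) {..<2}"
      using levy by (auto simp: cadlag_levy_process_def)
    from indep_var_compose[OF indep_var_restrict[OF iv, of "{0}" "{1}"], of "\<lambda>f. f 0" borel "\<lambda>f. f 1" borel]
    have indep: "indep_var borel U borel V"
      by (simp add: comp_def U_def[abs_def] V_def[abs_def] \<tau>_def)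
    have iU: "integrable M U" and iV: "integrable M V" and V0: "expectation V = 0"
      using 3 int zero unfolding U_def V_def by auto
    have UY: "AE \<omega> in M. (norm (Y s \<omega>))\<^sup>2 = (norm (U \<omega>))\<^sup>2"
      using Y0 by eventually_elim (simp add: U_def)
    have [measurable]: "U \<in> borel_measurable M" "V \<in> borel_measurable M" using iU iV by auto
    have iU2: "integrable M (\<lambda>\<omega>. (norm (U \<omega>))\<^sup>2)"
      using int2[OF assms(1)] by (subst integrable_cong_AE[THEN iffD1, OF _ _ UY]) auto
    have dV: "distr M borel V = distr M borel (Y t)"
      using levy 3 unfolding cadlag_levy_process_def V_def by auto
    have "integrable (distr M borel V) (\<lambda>y. (norm y)\<^sup>2)"
      unfolding dV by (subst integrable_distr_eq) (use int2 3 in auto)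
    then have iV2: "integrable M (\<lambda>\<omega>. (norm (V \<omega>))\<^sup>2)"
      by (subst (asm) integrable_distr_eq) auto
    have "(\<integral>\<omega>. (norm (V \<omega>))\<^sup>2 \<partial>M) = (\<integral>y. (norm y)\<^sup>2 \<partial>distr M borel V)"
      by (subst integral_distr) auto
    also have "\<dots> = (\<integral>\<omega>. (norm (Y t \<omega>))\<^sup>2 \<partial>M)"
      unfolding dV by (subst integral_distr) auto
    finally have EV: "(\<integral>\<omega>. (norm (V \<omega>))\<^sup>2 \<partial>M) = (\<integral>\<omega>. (norm (Y t \<omega>))\<^sup>2 \<partial>M)" .
    have EU: "(\<integral>\<omega>. (norm (Y s \<omega>))\<^sup>2 \<partial>M) = (\<integral>\<omega>. (norm (U \<omega>))\<^sup>2 \<partial>M)"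
      by (rule integral_cong_AE[OF _ _ UY]) auto
    have "(\<integral>\<omega>. (norm (Y (s + t) \<omega>))\<^sup>2 \<partial>M) = (\<integral>\<omega>. (norm (U \<omega>))\<^sup>2 + (norm (V \<omega>))\<^sup>2 + 2 * (U \<omega> \<bullet> V \<omega>) \<partial>M)"
    proof (rule integral_cong_AE)
      show "AE \<omega> in M. (norm (Y (s + t) \<omega>))\<^sup>2 = (norm (U \<omega>))\<^sup>2 + (norm (V \<omega>))\<^sup>2 + 2 * (U \<omega> \<bullet> V \<omega>)"
        using Y0
      proof eventually_elim
        case (elim \<omega>)
        then have "Y (s + t) \<omega> = U \<omega> + V \<omega>" by (simp add: U_def V_def)
        then show ?case by (simp add: power2_norm_eq_inner algebra_simps inner_commute)
      qed
    qed measurable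
    also have "\<dots> = (\<integral>\<omega>. (norm (U \<omega>))\<^sup>2 \<partial>M) + (\<integral>\<omega>. (norm (V \<omega>))\<^sup>2 \<partial>M)"
      using indep_var_inner_mean_zero[OF indep iU iU2 iV iV2 V0] iU2 iV2 by simp
    finally show ?thesis by (simp add: EU EV)
  qed (use m0 in auto)
qed

text \<open>The second moment is additive and nonnegative in time, hence monotone. Rounding the time up
to an integer, where additivity determines it, gives the linear bound.\<close>

lemma levy_second_moment_le:
  assumes "0 \<le> s"
  shows "(\<integral>\<omega>. (norm (Y s \<omega>))\<^sup>2 \<partial>M) \<le> (s + 1) * (\<integral>\<omega>. (norm (Y 1 \<omega>))\<^sup>2 \<partial>M)"
proof -
  define v where "v s = (\<integral>\<omega>. (norm (Y s \<omega>))\<^sup>2 \<partial>M)" for s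
  have v0: "0 \<le> v s" for s unfolding v_def by (intro integral_nonneg_AE) simp
  have add: "v (s + t) = v s + v t" if "0 \<le> s" "0 \<le> t" for s t
    using levy_second_moment_add[OF that] by (simp add: v_def)
  have vn: "v (real n) = real n * v 1" for n
  proof (induction n)
    case 0
    show ?case using add[of 0 0] by simp
  next
    case (Suc n)
    then show ?case using add[of "real n" 1] by (simp add: algebra_simps)
  qed
  let ?n = "nat \<lceil>s\<rceil>"
  have n: "s \<le> real ?n" "real ?n \<le> s + 1" using assms by linarith+
  have "v s \<le> v s + v (real ?n - s)" using v0 by simp
  also have "\<dots> = v (real ?n)" using add[of s "real ?n - s"] assms n by simp
  also have "\<dots> \<le> (s + 1) * v 1" unfolding vn using n v0 by (intro mult_right_mono) auto
  finally show ?thesis by (simp add: v_def)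
qed

text \<open>The weighted inequality \<open>2 * norm y \<le> (norm y)\<^sup>2 / a + a\<close> with \<open>a = sqrt (s + 1)\<close> converts
linear growth of the second moment into square root growth of the first one. This is
where the square root in the hypothesis on the random time comes from.\<close>

lemma levy_first_moment_le:
  assumes "0 \<le> s"
  shows "(\<integral>\<omega>. norm (Y s \<omega>) \<partial>M) \<le> (1 + (\<integral>\<omega>. (norm (Y 1 \<omega>))\<^sup>2 \<partial>M)) * (1 + sqrt s)"
proof -
  let ?v = "\<integral>\<omega>. (norm (Y 1 \<omega>))\<^sup>2 \<partial>M" and ?a = "sqrt (s + 1)"
  have v0: "0 \<le> ?v" by (intro integral_nonneg_AE) simp
  have n0: "0 \<le> (\<integral>\<omega>. norm (Y s \<omega>) \<partial>M)" by (intro integral_nonneg_AE) simp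
  have a: "0 < ?a" using assms by simp
  have "2 * norm y \<le> (norm y)\<^sup>2 / ?a + ?a" for y :: 'h
  proof -
    have "2 * norm y * ?a \<le> (norm y)\<^sup>2 + ?a\<^sup>2" by (rule sum_squares_bound)
    then show ?thesis using a by (simp add: field_simps power2_eq_square)
  qed
  then have "(\<integral>\<omega>. 2 * norm (Y s \<omega>) \<partial>M) \<le> (\<integral>\<omega>. (norm (Y s \<omega>))\<^sup>2 / ?a + ?a \<partial>M)"
    using int[OF assms] int2[OF assms] by (intro integral_mono) auto
  also have "\<dots> = (\<integral>\<omega>. (norm (Y s \<omega>))\<^sup>2 \<partial>M) / ?a + ?a"
    using int2[OF assms] by (simp add: prob_space)
  also have "\<dots> \<le> (s + 1) * ?v / ?a + ?a"
    using levy_second_moment_le[OF assms] a by (intro add_right_mono divide_right_mono) auto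
  also have "(s + 1) * ?v / ?a = ?v * ((s + 1) / ?a)" by simp
  also have "(s + 1) / ?a = ?a" using assms by (intro real_div_sqrt) simp
  finally have "2 * (\<integral>\<omega>. norm (Y s \<omega>) \<partial>M) \<le> (1 + ?v) * ?a"
    by (simp add: algebra_simps)
  then have "(\<integral>\<omega>. norm (Y s \<omega>) \<partial>M) \<le> (1 + ?v) * ?a" using n0 by linarith
  also have "\<dots> \<le> (1 + ?v) * (1 + sqrt s)"
    using v0 assms sqrt_add_le_add_sqrt[of s 1] by (intro mult_left_mono) auto
  finally show ?thesis .
qed

end

section \<open>Independent random times\<close>

text \<open>The value of the path at time \<open>s\<close>, recovered from the grid points \<open>k / Suc i\<close> strictly to the
right of \<open>s\<close>. Each approximation reads the process at countably many times, which makes the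
limit jointly measurable in time and sample. The floor plus one selects a grid
point strictly larger than \<open>s\<close>, as right-continuity is expressed by the filter \<open>at_right\<close>,
and \<open>max 0\<close> keeps all times in the meaningful range.\<close>

definition grid_right_limit :: "(real \<Rightarrow> 'a \<Rightarrow> 'b::real_normed_vector) \<Rightarrow> real \<Rightarrow> 'a \<Rightarrow> 'b" where
  "grid_right_limit Y s \<omega> =
     lim (\<lambda>i. Y ((real_of_int \<lfloor>real (Suc i) * max 0 s\<rfloor> + 1) / real (Suc i)) \<omega>)"

lemma grid_right_limit_eq:
  assumes cadlag: "cadlag (\<lambda>t. Y t \<omega>)" and s: "0 \<le> s"
  shows "grid_right_limit Y s \<omega> = Y s \<omega>"
proof -
  define \<tau> where "\<tau> i = (real_of_int \<lfloor>real (Suc i) * s\<rfloor> + 1) / real (Suc i)" for i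
  have lower: "s < \<tau> i" and upper: "\<tau> i \<le> s + 1 / real (Suc i)" for i
  proof -
    have "real (Suc i) * s < real_of_int \<lfloor>real (Suc i) * s\<rfloor> + 1" by linarith
    then show "s < \<tau> i"
      unfolding \<tau>_def by (simp add: pos_less_divide_eq mult.commute del: of_nat_Suc)
    have "\<tau> i \<le> (real (Suc i) * s + 1) / real (Suc i)"
      unfolding \<tau>_def by (intro divide_right_mono) linarith+
    also have "\<dots> = s + 1 / real (Suc i)" by (simp add: add_divide_distrib del: of_nat_Suc)
    finally show "\<tau> i \<le> s + 1 / real (Suc i)" .
  qed
  have "(\<lambda>i. s + 1 / real (Suc i)) \<longlonglongrightarrow> s + 0"
    by (intro tendsto_add tendsto_const LIMSEQ_Suc[OF lim_1_over_n])
  then have "\<tau> \<longlonglongrightarrow> s"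
    using lower upper by (intro tendsto_sandwich[of "\<lambda>_. s" \<tau> sequentially "\<lambda>i. s + 1 / real (Suc i)"])
      (auto intro!: always_eventually less_imp_le)
  then have "filterlim \<tau> (at_right s) sequentially"
    using lower by (auto simp: filterlim_at intro!: always_eventually less_imp_neq[THEN not_sym])
  moreover have "((\<lambda>t. Y t \<omega>) \<longlongrightarrow> Y s \<omega>) (at_right s)"
    using cadlag s by (simp add: cadlag_def)
  ultimately have "(\<lambda>i. Y (\<tau> i) \<omega>) \<longlonglongrightarrow> Y s \<omega>" by (rule filterlim_compose[rotated])
  then show ?thesis
    using s unfolding grid_right_limit_def \<tau>_def by (simp add: limI max_absorb2)
qed

lemma grid_right_limit_measurable:
  fixes Y :: "real \<Rightarrow> 'a \<Rightarrow> 'b::{banach, second_countable_topology}"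
  assumes Y: "\<And>t. 0 \<le> t \<Longrightarrow> Y t \<in> borel_measurable N"
  shows "(\<lambda>p. grid_right_limit Y (fst p) (snd p)) \<in> borel_measurable (borel \<Otimes>\<^sub>M N)"
  unfolding grid_right_limit_def
proof (rule borel_measurable_lim_metric[where f = "\<lambda>i p.
    Y ((real_of_int \<lfloor>real (Suc i) * max 0 (fst p)\<rfloor> + 1) / real (Suc i)) (snd p)"])
  fix i
  have "(\<lambda>p. Y ((real (nat \<lfloor>real (Suc i) * max 0 (fst p)\<rfloor>) + 1) / real (Suc i)) (snd p))
      \<in> borel_measurable (borel \<Otimes>\<^sub>M N)"
  proof (rule measurable_compose_countable[where f = "\<lambda>k p. Y ((real k + 1) / real (Suc i)) (snd p)"
        and g = "\<lambda>p. nat \<lfloor>real (Suc i) * max 0 (fst p)\<rfloor>"])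
    show "(\<lambda>p. Y ((real k + 1) / real (Suc i)) (snd p)) \<in> borel_measurable (borel \<Otimes>\<^sub>M N)" for k
      by (rule measurable_compose[OF measurable_snd Y]) simp
  qed measurable
  then show "(\<lambda>p. Y ((real_of_int \<lfloor>real (Suc i) * max 0 (fst p)\<rfloor> + 1) / real (Suc i)) (snd p))
      \<in> borel_measurable (borel \<Otimes>\<^sub>M N)"
    by (simp add: of_nat_nat del: of_nat_Suc)
qed

text \<open>Independence is the product formula on measurable rectangles, and these determine the joint
law. The maps may take values in different types, as in the pairing of a real random time
with the sample point.\<close>

lemma (in prob_space) distr_Pair_indep_set:
  assumes X[measurable]: "X \<in> measurable M S" and Y[measurable]: "Y \<in> measurable M T"
    and indep: "indep_set {X -` A \<inter> space M | A. A \<in> sets S} {Y -` B \<inter> space M | B. B \<in> sets T}"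
  shows "distr M S X \<Otimes>\<^sub>M distr M T Y = distr M (S \<Otimes>\<^sub>M T) (\<lambda>\<omega>. (X \<omega>, Y \<omega>))"
proof -
  interpret DX: prob_space "distr M S X" by (rule prob_space_distr) measurable
  interpret DY: prob_space "distr M T Y" by (rule prob_space_distr) measurable
  show ?thesis
  proof (rule pair_measure_eqI)
    show "sigma_finite_measure (distr M S X)" "sigma_finite_measure (distr M T Y)" ..
    fix A B assume "A \<in> sets (distr M S X)" "B \<in> sets (distr M T Y)"
    then have [measurable]: "A \<in> sets S" "B \<in> sets T" by simp_all
    have "prob ((X -` A \<inter> space M) \<inter> (Y -` B \<inter> space M)) = prob (X -` A \<inter> space M) * prob (Y -` B \<inter> space M)"
      by (rule indep_setD[OF indep]) auto
    moreover have "(X -` A \<inter> space M) \<inter> (Y -` B \<inter> space M) = (\<lambda>\<omega>. (X \<omega>, Y \<omega>)) -` (A \<times> B) \<inter> space M"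
      by auto
    ultimately show "emeasure (distr M S X) A * emeasure (distr M T Y) B =
        emeasure (distr M (S \<Otimes>\<^sub>M T) (\<lambda>\<omega>. (X \<omega>, Y \<omega>))) (A \<times> B)"
      by (simp add: emeasure_distr emeasure_eq_measure ennreal_mult'')
  qed simp
qed

text \<open>Freezing: let \<open>N\<close> carry the \<open>\<sigma>\<close>-algebra of the process. As the time \<open>T\<close> is independent of it,
the pair of \<open>T\<close> and the sample point has a product law, so Fubini's theorem applies to
\<open>grid_right_limit Y\<close>. For a fixed time the inner integrals are those of \<open>Y\<close> at that time: the
mean vanishes, and the mean norm is at most \<open>C * (1 + sqrt s)\<close>, which is integrable over the
law of \<open>T\<close>. The conclusion speaks of an almost surely equal \<open>Z\<close> because the regularity of the
paths, and with it the measurability of \<open>Y (T \<omega>) \<omega>\<close>, is known only up to null sets.\<close>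

lemma (in prob_space) integrable_independent_time_change:
  fixes Y :: "real \<Rightarrow> 'a \<Rightarrow> 'b::{banach, second_countable_topology}" and T :: "'a \<Rightarrow> real"
  assumes T[measurable]: "T \<in> borel_measurable M"
    and N_space: "space N = space M" and N[measurable]: "(\<lambda>\<omega>. \<omega>) \<in> measurable M N"
    and indep: "indep_set {T -` A \<inter> space M | A. A \<in> sets borel} (sets N)"
    and Y_N: "\<And>t. 0 \<le> t \<Longrightarrow> Y t \<in> borel_measurable N"
    and cadlag: "AE \<omega> in M. cadlag (\<lambda>t. Y t \<omega>)"
    and int: "\<And>t. 0 \<le> t \<Longrightarrow> integrable M (Y t)"
    and zero: "\<And>t. 0 \<le> t \<Longrightarrow> expectation (Y t) = 0"
    and growth: "\<And>t. 0 \<le> t \<Longrightarrow> expectation (\<lambda>\<omega>. norm (Y t \<omega>)) \<le> C * (1 + sqrt t)"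
    and T_nonneg: "AE \<omega> in M. 0 \<le> T \<omega>"
    and T_int: "integrable M (\<lambda>\<omega>. sqrt \<bar>T \<omega>\<bar>)"
  obtains Z where "integrable M Z" "expectation Z = 0" "AE \<omega> in M. Z \<omega> = Y (T \<omega>) \<omega>"
proof
  let ?f = "\<lambda>p. grid_right_limit Y (fst p) (snd p)"
  let ?P = "distr M borel T" and ?Q = "distr M N (\<lambda>\<omega>. \<omega>)"
  let ?Z = "\<lambda>\<omega>. grid_right_limit Y (T \<omega>) \<omega>"
  have law: "?P \<Otimes>\<^sub>M ?Q = distr M (borel \<Otimes>\<^sub>M N) (\<lambda>\<omega>. (T \<omega>, \<omega>))"
  proof (rule distr_Pair_indep_set[OF T N])
    have *: "(\<lambda>\<omega>. \<omega>) -` B \<inter> space M = B" if "B \<in> sets N" for B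
      using sets.sets_into_space[OF that] by (auto simp: N_space)
    have "{(\<lambda>\<omega>. \<omega>) -` B \<inter> space M | B. B \<in> sets N} = sets N"
      unfolding Setcompr_eq_image by (subst image_cong[OF refl *]) auto
    then show "indep_set {T -` A \<inter> space M | A. A \<in> sets borel} {(\<lambda>\<omega>. \<omega>) -` B \<inter> space M | B. B \<in> sets N}"
      using indep by simp
  qed
  have f[measurable]: "?f \<in> borel_measurable (borel \<Otimes>\<^sub>M N)"
    using Y_N by (rule grid_right_limit_measurable)
  have f_section[measurable]: "grid_right_limit Y s \<in> borel_measurable N" for s
    using measurable_compose[OF measurable_Pair1' f, of s] by simp
  have f_section_M[measurable]: "grid_right_limit Y s \<in> borel_measurable M" for s
    using measurable_compose[OF N f_section] .
  have Y_M: "Y t \<in> borel_measurable M" if "0 \<le> t" for t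
    using measurable_compose[OF N Y_N[OF that]] .
  have max0: "grid_right_limit Y s = grid_right_limit Y (max 0 s)" for s
    by (simp add: grid_right_limit_def fun_eq_iff)
  \<comment> \<open>At a fixed time the regularised process agrees almost surely with the original one.\<close>
  have frozen: "AE \<omega> in M. grid_right_limit Y s \<omega> = Y (max 0 s) \<omega>" for s
    using cadlag by eventually_elim (subst max0, rule grid_right_limit_eq, auto)
  have sec_int: "integrable M (grid_right_limit Y s)" for s
    using int[of "max 0 s"] by (subst integrable_cong_AE[OF _ _ frozen]) (auto intro: Y_M)
  have sec_zero: "expectation (grid_right_limit Y s) = 0" for s
    using zero[of "max 0 s"] by (subst integral_cong_AE[OF _ _ frozen]) (auto intro: Y_M)
  have sec_norm: "expectation (\<lambda>\<omega>. norm (grid_right_limit Y s \<omega>)) \<le> C * (1 + sqrt \<bar>s\<bar>)" for s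
  proof -
    have [measurable]: "Y (max 0 s) \<in> borel_measurable M" by (rule Y_M) simp
    have "expectation (\<lambda>\<omega>. norm (grid_right_limit Y s \<omega>)) = expectation (\<lambda>\<omega>. norm (Y (max 0 s) \<omega>))"
      using frozen[of s] by (intro integral_cong_AE) auto
    also have "\<dots> \<le> C * (1 + sqrt (max 0 s))" by (rule growth) simp
    also have "\<dots> \<le> C * (1 + sqrt \<bar>s\<bar>)"
    proof -
      have "0 \<le> C" using order_trans[OF integral_nonneg_AE growth[of 0]] by simp
      then show ?thesis by (intro mult_left_mono add_left_mono real_sqrt_le_mono) auto
    qed
    finally show ?thesis .
  qed

  interpret P: prob_space ?P by (rule prob_space_distr) measurable
  interpret Q: prob_space ?Q by (rule prob_space_distr) measurable
  interpret PQ: pair_prob_space ?P ?Q ..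
  have int_pair: "integrable (?P \<Otimes>\<^sub>M ?Q) ?f"
  proof (rule PQ.Fubini_integrable)
    show "?f \<in> borel_measurable (?P \<Otimes>\<^sub>M ?Q)" by measurable
    show "AE s in ?P. integrable ?Q (\<lambda>\<omega>. ?f (s, \<omega>))"
      using sec_int by (intro AE_I2) (simp add: integrable_distr_eq)
    have norm_Q: "(\<integral>\<omega>. norm (?f (s, \<omega>)) \<partial>?Q) = (\<integral>\<omega>. norm (grid_right_limit Y s \<omega>) \<partial>M)" for s
      by (simp add: integral_distr)
    show "integrable ?P (\<lambda>s. \<integral>\<omega>. norm (?f (s, \<omega>)) \<partial>?Q)"
    proof (rule Bochner_Integration.integrable_bound)
      show "integrable ?P (\<lambda>s. C * (1 + sqrt \<bar>s\<bar>))"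
        using T_int by (subst integrable_distr_eq) auto
      show "(\<lambda>s. \<integral>\<omega>. norm (?f (s, \<omega>)) \<partial>?Q) \<in> borel_measurable ?P" by measurable
      have "\<bar>\<integral>\<omega>. norm (?f (s, \<omega>)) \<partial>?Q\<bar> \<le> \<bar>C * (1 + sqrt \<bar>s\<bar>)\<bar>" for s
      proof -
        have "0 \<le> (\<integral>\<omega>. norm (?f (s, \<omega>)) \<partial>?Q)" by (intro integral_nonneg_AE) simp
        then show ?thesis using sec_norm[of s] unfolding norm_Q by linarith
      qed
      then show "AE s in ?P. norm (\<integral>\<omega>. norm (?f (s, \<omega>)) \<partial>?Q) \<le> norm (C * (1 + sqrt \<bar>s\<bar>))" by simp
    qed
  qed
  have TN: "(\<lambda>\<omega>. (T \<omega>, \<omega>)) \<in> measurable M (borel \<Otimes>\<^sub>M N)" by measurable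
  show "integrable M ?Z"
    using int_pair unfolding law by (subst (asm) integrable_distr_eq[OF TN f]) simp
  have "expectation ?Z = integral\<^sup>L (?P \<Otimes>\<^sub>M ?Q) ?f"
    unfolding law by (subst integral_distr[OF TN f]) simp
  also have "\<dots> = (\<integral>s. (\<integral>\<omega>. ?f (s, \<omega>) \<partial>?Q) \<partial>?P)" by (rule PQ.integral_fst'[OF int_pair, symmetric])
  also have "\<dots> = (\<integral>s. 0 \<partial>?P)"
    using sec_zero by (intro Bochner_Integration.integral_cong refl) (simp add: integral_distr)
  finally show "expectation ?Z = 0" by simp
  show "AE \<omega> in M. ?Z \<omega> = Y (T \<omega>) \<omega>"
    using cadlag T_nonneg by eventually_elim (rule grid_right_limit_eq)
qed

section \<open>Almost sure versions and components\<close>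

lemma borel_measurable_completion_AE_eq:
  fixes f g :: "'a \<Rightarrow> 'b::topological_space"
  assumes f: "f \<in> borel_measurable M" and eq: "AE x in M. f x = g x"
  shows "g \<in> borel_measurable (completion M)"
proof (rule measurableI)
  fix A :: "'b set" assume A: "A \<in> sets borel"
  have "AE x in M. x \<in> f -` A \<inter> space M \<longleftrightarrow> x \<in> g -` A \<inter> space M"
    using eq by eventually_elim auto
  then have "AE x in completion M. x \<in> f -` A \<inter> space M \<longleftrightarrow> x \<in> g -` A \<inter> space M"
    by (rule AE_completion)
  moreover have "f -` A \<inter> space M \<in> sets (completion M)" using measurable_sets[OF f A] by auto
  ultimately show "g -` A \<inter> space (completion M) \<in> sets (completion M)"
    using completion.in_sets_AE[of "f -` A \<inter> space M" "g -` A \<inter> space M" M] by simp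
qed simp

lemma integral_completion_AE_eq:
  fixes f g :: "'a \<Rightarrow> 'b::{banach, second_countable_topology}"
  assumes f: "integrable M f" and eq: "AE x in M. f x = g x"
  shows "integrable (completion M) g" and "integral\<^sup>L (completion M) g = integral\<^sup>L M f"
proof -
  have fM: "f \<in> borel_measurable M" using f by auto
  then have g: "g \<in> borel_measurable (completion M)" using eq by (rule borel_measurable_completion_AE_eq)
  have eq': "AE x in completion M. f x = g x" using eq by (rule AE_completion)
  have f': "integrable (completion M) f" using f fM by (simp add: integrable_completion)
  show "integrable (completion M) g"
    using integrable_cong_AE[OF measurable_completion[OF fM] g eq'] f' by simp
  show "integral\<^sup>L (completion M) g = integral\<^sup>L M f"
    using integral_cong_AE[OF measurable_completion[OF fM] g eq'] fM by (simp add: integral_completion)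
qed

lemma
  fixes f :: "'a \<Rightarrow> 'b::{real_inner, banach, second_countable_topology} ^ 'd::finite"
  assumes "\<And>j. integrable M (\<lambda>x. f x $ j)"
  shows integrable_vec: "integrable M f"
    and integral_vec_nth: "integral\<^sup>L M f $ j = (\<integral>x. f x $ j \<partial>M)"
proof -
  have decomp: "v = (\<Sum>j\<in>UNIV. axis j (v $ j))" for v :: "'b ^ 'd"
    by (simp add: vec_eq_iff axis_def if_distrib cong: if_cong)
  have lin: "bounded_linear (axis j :: 'b \<Rightarrow> 'b ^ 'd)" for j
  proof (rule bounded_linear_intro[where K = 1])
    show "norm (axis j x :: 'b ^ 'd) \<le> norm x * 1" for x :: 'b
      by (simp add: norm_eq_sqrt_inner inner_axis_axis)
  qed (auto simp: axis_def vec_eq_iff)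
  have "integrable M (\<lambda>x. \<Sum>j\<in>UNIV. axis j (f x $ j))"
    using assms by (intro Bochner_Integration.integrable_sum integrable_bounded_linear[OF lin])
  moreover have "(\<lambda>x. \<Sum>j\<in>UNIV. axis j (f x $ j)) = f" by (rule ext, rule decomp[symmetric])
  ultimately show int: "integrable M f" by (simp only:)
  show "integral\<^sup>L M f $ j = (\<integral>x. f x $ j \<partial>M)"
    using integral_bounded_linear[OF bounded_linear_vec_nth int] by simp
qed

section \<open>The subordinated process\<close>

text \<open>The square root is subadditive and the increments over unit intervals have the law of
\<open>X 1\<close>, so integrability spreads to all integer times; monotone paths cover the times in
between.\<close>

lemma subordinator_sqrt_integrable:
  assumes M: "prob_space M" and sub: "subordinator M X"
    and one: "integrable M (\<lambda>\<omega>. sqrt \<bar>X 1 \<omega>\<bar>)" and t: "0 \<le> t"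
  shows "integrable M (\<lambda>\<omega>. sqrt \<bar>X t \<omega>\<bar>)" and "AE \<omega> in M. 0 \<le> X t \<omega>"
proof -
  have levy: "cadlag_levy_process M X" and mono: "AE \<omega> in M. mono_on {0..} (\<lambda>t. X t \<omega>)"
    using sub by (auto simp: subordinator_def)
  have meas[measurable]: "\<And>r. 0 \<le> r \<Longrightarrow> X r \<in> borel_measurable M"
    and zero: "AE \<omega> in M. X 0 \<omega> = 0"
    and incr: "\<And>r s. 0 \<le> r \<Longrightarrow> 0 \<le> s \<Longrightarrow> distr M borel (\<lambda>\<omega>. X (r + s) \<omega> - X r \<omega>) = distr M borel (X s)"
    using levy by (auto simp: cadlag_levy_process_def)
  show nonneg: "AE \<omega> in M. 0 \<le> X t \<omega>"
    using mono zero
  proof eventually_elim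
    case (elim \<omega>)
    then show ?case using monotone_onD[OF elim(1), of 0 t] t by simp
  qed
  have int_nat: "integrable M (\<lambda>\<omega>. sqrt \<bar>X (real n) \<omega>\<bar>)" for n
  proof (induction n)
    case 0
    have "integrable M (\<lambda>\<omega>. sqrt \<bar>X 0 \<omega>\<bar>) \<longleftrightarrow> integrable M (\<lambda>\<omega>. 0 :: real)"
      using zero by (intro integrable_cong_AE) auto
    then show ?case by simp
  next
    case (Suc n)
    have [measurable]: "X (real n) \<in> borel_measurable M" "X (real n + 1) \<in> borel_measurable M" "X 1 \<in> borel_measurable M"
      by auto
    have D: "distr M borel (\<lambda>\<omega>. X (real n + 1) \<omega> - X (real n) \<omega>) = distr M borel (X 1)"
      by (rule incr) auto
    have "integrable (distr M borel (X 1)) (\<lambda>x. sqrt \<bar>x\<bar>)"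
      using one by (subst integrable_distr_eq) auto
    then have step: "integrable M (\<lambda>\<omega>. sqrt \<bar>X (real n + 1) \<omega> - X (real n) \<omega>\<bar>)"
      unfolding D[symmetric] by (subst (asm) integrable_distr_eq) auto
    have "integrable M (\<lambda>\<omega>. sqrt \<bar>X (real n + 1) \<omega>\<bar>)"
    proof (rule Bochner_Integration.integrable_bound)
      show "integrable M (\<lambda>\<omega>. sqrt \<bar>X (real n) \<omega>\<bar> + sqrt \<bar>X (real n + 1) \<omega> - X (real n) \<omega>\<bar>)"
        using Suc.IH step by (rule Bochner_Integration.integrable_add)
      have "sqrt \<bar>b\<bar> \<le> sqrt \<bar>a\<bar> + sqrt \<bar>b - a\<bar>" for a b :: real
      proof -
        have "sqrt \<bar>b\<bar> \<le> sqrt (\<bar>a\<bar> + \<bar>b - a\<bar>)" by (rule real_sqrt_le_mono) linarith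
        also have "\<dots> \<le> sqrt \<bar>a\<bar> + sqrt \<bar>b - a\<bar>" by (rule sqrt_add_le_add_sqrt) auto
        finally show ?thesis .
      qed
      then show "AE \<omega> in M. norm (sqrt \<bar>X (real n + 1) \<omega>\<bar>)
          \<le> norm (sqrt \<bar>X (real n) \<omega>\<bar> + sqrt \<bar>X (real n + 1) \<omega> - X (real n) \<omega>\<bar>)"
        by (simp add: abs_of_nonneg)
    qed measurable
    then show ?case by (simp add: add.commute)
  qed
  show "integrable M (\<lambda>\<omega>. sqrt \<bar>X t \<omega>\<bar>)"
  proof (rule Bochner_Integration.integrable_bound[OF int_nat[of "nat \<lceil>t\<rceil>"]])
    have [measurable]: "X t \<in> borel_measurable M" using t by auto
    show "(\<lambda>\<omega>. sqrt \<bar>X t \<omega>\<bar>) \<in> borel_measurable M" by measurable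
    have le: "t \<le> real (nat \<lceil>t\<rceil>)" by linarith
    show "AE \<omega> in M. norm (sqrt \<bar>X t \<omega>\<bar>) \<le> norm (sqrt \<bar>X (real (nat \<lceil>t\<rceil>)) \<omega>\<bar>)"
      using mono nonneg
    proof eventually_elim
      case (elim \<omega>)
      then show ?case using monotone_onD[OF elim(1), of t "real (nat \<lceil>t\<rceil>)"] t le by simp
    qed
  qed
qed

theorem theorem3p9:
  fixes M :: "'a measure"
    and H :: "'d::finite \<Rightarrow> 'h::{real_inner, banach, second_countable_topology} set"
    and L :: "'d \<Rightarrow> real \<Rightarrow> 'a \<Rightarrow> 'h"
    and \<Theta> :: "real \<Rightarrow> 'a \<Rightarrow> real ^ 'd"
    and F :: "(real ^ 'd) measure"
  assumes "subordination_setting M H L \<Theta> F"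
    and "square_integrable_process M (joint_process L)"
    and "martingale_own_filtration M (joint_process L)"
  shows "(integrable M (\<lambda>\<omega>. sqrt (norm (\<Theta> 1 \<omega>))) \<longleftrightarrow>
            (\<integral>\<^sup>+ \<theta>\<in>{\<theta>. 1 < norm \<theta>}. ennreal (sqrt (norm \<theta>)) \<partial>F) < \<infinity>) \<and>
         (integrable M (\<lambda>\<omega>. sqrt (norm (\<Theta> 1 \<omega>))) \<longrightarrow>
            mean_zero (completion M) (subordinated_process L \<Theta>))"
proof (intro conjI impI)
  interpret subordination_setting M H L \<Theta> F by fact
  interpret prob_space M by (rule prob)
  let ?J = "joint_process L"
  have \<Theta>[measurable]: "\<Theta> t \<in> borel_measurable M" if "0 \<le> t" for t
    using Theta_levy that by (simp add: cadlag_levy_process_def)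
  show "integrable M (\<lambda>\<omega>. sqrt (norm (\<Theta> 1 \<omega>))) \<longleftrightarrow>
      (\<integral>\<^sup>+ \<theta>\<in>{\<theta>. 1 < norm \<theta>}. ennreal (sqrt (norm \<theta>)) \<partial>F) < \<infinity>"
    by (rule levy_sqrt_moment_iff[OF prob _ F_levy_measure]) simp

  assume sqrt_int: "integrable M (\<lambda>\<omega>. sqrt (norm (\<Theta> 1 \<omega>)))"
  have J_nth: "?J s \<omega> $ j = L j s \<omega>" for s \<omega> j by (simp add: joint_process_def)
  have J_int: "integrable M (?J s)" if "0 \<le> s" for s
    using assms(3) that by (simp add: martingale_own_filtration_def integrable_process_def)
  have L_int: "integrable M (L j s)" if "0 \<le> s" for j s
    using integrable_bounded_linear[OF bounded_linear_vec_nth J_int[OF that], of j] by (simp add: J_nth)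
  \<comment> \<open>A martingale has constant mean, and the process starts at zero.\<close>
  have L_zero: "expectation (L j s) = 0" if s: "0 \<le> s" for j s
  proof -
    have "space M \<in> natural_filtration M ?J 0"
      unfolding natural_filtration_def by (rule sigma_sets_top)
    then have "set_lebesgue_integral M (space M) (?J s) = set_lebesgue_integral M (space M) (?J 0)"
      using assms(3) s by (simp add: martingale_own_filtration_def)
    then have "expectation (?J s) = expectation (?J 0)"
      using J_int[OF s] J_int[of 0] by (simp add: set_integral_space)
    then have "expectation (?J s) $ j = expectation (?J 0) $ j" by simp
    then have "expectation (L j s) = expectation (L j 0)"
      using integral_bounded_linear[OF bounded_linear_vec_nth J_int[OF s], of j]
        integral_bounded_linear[OF bounded_linear_vec_nth J_int[of 0], of j] by (simp add: J_nth)
    also have "\<dots> = 0"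
      using L_levy[of j] by (intro integral_eq_zero_AE) (simp add: cadlag_levy_process_def)
    finally show ?thesis .
  qed
  have L_int2: "integrable M (\<lambda>\<omega>. (norm (L j s \<omega>))\<^sup>2)" if s: "0 \<le> s" for j s
  proof (rule Bochner_Integration.integrable_bound)
    show "integrable M (\<lambda>\<omega>. (norm (?J s \<omega>))\<^sup>2)"
      using assms(2) s by (simp add: square_integrable_process_def)
    show "(\<lambda>\<omega>. (norm (L j s \<omega>))\<^sup>2) \<in> borel_measurable M" using L_int[OF s, of j] by measurable
    have "(norm (L j s \<omega>))\<^sup>2 \<le> (norm (?J s \<omega>))\<^sup>2" for \<omega>
      using Finite_Cartesian_Product.norm_nth_le[of "?J s \<omega>" j] by (intro power_mono) (simp_all add: J_nth)
    then show "AE \<omega> in M. norm ((norm (L j s \<omega>))\<^sup>2) \<le> norm ((norm (?J s \<omega>))\<^sup>2)" by simp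
  qed

  \<comment> \<open>The sample space with the \<open>\<sigma>\<close>-algebra generated by all components of \<open>L\<close>, which is independent of \<open>\<Theta>\<close>.\<close>
  define N where "N = sigma (space M) {?J s -` B \<inter> space M | s B. 0 \<le> s \<and> B \<in> sets borel}"
  have gen: "{?J s -` B \<inter> space M | s B. 0 \<le> s \<and> B \<in> sets borel} \<subseteq> Pow (space M)" by blast
  have sets_N: "sets N = generated_sigma_algebra M ?J"
    unfolding N_def generated_sigma_algebra_def by (rule sets_measure_of[OF gen])
  have space_N: "space N = space M" unfolding N_def by (rule space_measure_of[OF gen])
  have id_N: "(\<lambda>\<omega>. \<omega>) \<in> measurable M N"
    unfolding N_def
  proof (rule measurable_measure_of[OF gen])
    fix A assume "A \<in> {?J s -` B \<inter> space M | s B. 0 \<le> s \<and> B \<in> sets borel}"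
    then obtain s B where "0 \<le> s" "B \<in> sets borel" "A = ?J s -` B \<inter> space M" by blast
    then have "A \<in> sets M" using measurable_sets[OF borel_measurable_integrable[OF J_int]] by simp
    then show "(\<lambda>\<omega>. \<omega>) -` A \<inter> space M \<in> sets M" by (simp add: vimage_def Int_def[symmetric] sets.Int)
  qed simp
  have L_N: "L j s \<in> borel_measurable N" if "0 \<le> s" for j s
  proof -
    have "?J s \<in> borel_measurable N"
    proof (rule measurableI)
      fix B :: "('h ^ 'd) set" assume "B \<in> sets borel"
      then show "?J s -` B \<inter> space N \<in> sets N"
        unfolding sets_N space_N generated_sigma_algebra_def using that by blast
    qed simp
    from borel_measurable_vec_nth[OF this, of j] show ?thesis by (simp add: J_nth)
  qed

  show "mean_zero (completion M) (subordinated_process L \<Theta>)"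
  proof -
    have main: "integrable (completion M) (subordinated_process L \<Theta> t) \<and>
        integral\<^sup>L (completion M) (subordinated_process L \<Theta> t) = 0" if t: "0 \<le> t" for t
    proof -
      have "\<exists>Z. integrable M Z \<and> expectation Z = 0 \<and> (AE \<omega> in M. Z \<omega> = L j (\<Theta> t \<omega> $ j) \<omega>)" for j
      proof -
        have "integrable M (\<lambda>\<omega>. sqrt \<bar>\<Theta> 1 \<omega> $ j\<bar>)"
        proof (rule Bochner_Integration.integrable_bound[OF sqrt_int])
          have [measurable]: "\<Theta> 1 \<in> borel_measurable M" by (rule \<Theta>) simp
          show "(\<lambda>\<omega>. sqrt \<bar>\<Theta> 1 \<omega> $ j\<bar>) \<in> borel_measurable M" by measurable
        qed (simp add: component_le_norm_cart)
        note T = subordinator_sqrt_integrable[OF prob Theta_subordinator[of j] this t]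
        have indep: "indep_set {(\<lambda>\<omega>. \<Theta> t \<omega> $ j) -` A \<inter> space M | A. A \<in> sets borel} (sets N)"
        proof -
          have "(\<lambda>\<omega>. \<Theta> t \<omega> $ j) -` A \<inter> space M \<in> generated_sigma_algebra M \<Theta>"
            if A: "A \<in> sets borel" for A
          proof -
            have "(\<lambda>x :: real ^ 'd. x $ j) -` A \<inter> space borel \<in> sets borel"
              by (rule measurable_sets[OF borel_measurable_vec_nth A]) simp
            moreover have "(\<lambda>\<omega>. \<Theta> t \<omega> $ j) -` A \<inter> space M =
                \<Theta> t -` ((\<lambda>x. x $ j) -` A \<inter> space borel) \<inter> space M" by auto
            ultimately show ?thesis
              unfolding generated_sigma_algebra_def using t by blast
          qed
          then show ?thesis
            using Theta_L_indep unfolding indep_set_def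
            by (elim indep_sets_mono_sets) (auto simp: sets_N split: bool.split)
        qed
        show ?thesis
        proof (rule integrable_independent_time_change[OF _ space_N id_N indep L_N _ L_int L_zero
              levy_first_moment_le[OF prob L_levy L_int L_int2 L_zero] T(2,1)])
          show "(\<lambda>\<omega>. \<Theta> t \<omega> $ j) \<in> borel_measurable M" using \<Theta>[OF t] by measurable
          show "AE \<omega> in M. cadlag (\<lambda>t. L j t \<omega>)" using L_levy[of j] by (simp add: cadlag_levy_process_def)
        qed blast+
      qed
      then obtain Z where Z: "\<And>j. integrable M (Z j)" "\<And>j. expectation (Z j) = 0"
        and Z_eq: "\<And>j. AE \<omega> in M. Z j \<omega> = L j (\<Theta> t \<omega> $ j) \<omega>" by metis
      let ?W = "\<lambda>\<omega>. \<chi> j. Z j \<omega>"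
      have W: "integrable M ?W" using Z(1) by (intro integrable_vec) simp
      have W0: "expectation ?W = 0"
        using Z by (simp add: vec_eq_iff integral_vec_nth)
      have "AE \<omega> in M. \<forall>j\<in>UNIV. Z j \<omega> = L j (\<Theta> t \<omega> $ j) \<omega>"
        using Z_eq by (intro AE_finite_allI) auto
      then have "AE \<omega> in M. ?W \<omega> = subordinated_process L \<Theta> t \<omega>"
        by eventually_elim (simp add: subordinated_process_def)
      from integral_completion_AE_eq[OF W this] W0 show ?thesis by simp
    qed
    then show ?thesis by (simp add: mean_zero_def integrable_process_def)
  qed
qed

end
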